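(* Let $S^1=(s^1_{0,0},\ldots,s^1_{0,m_1})=\mathcal N(\sigma^1_0,\ldots,\sigma^1_{m_1})$ and $S^2=(s^2_{0,0},\ldots,s^2_{0,m_2})=\mathcal N(\sigma^2_0,\ldots,\sigma^2_{m_2})$ be Nikishin systems with $\sigma^1_0=\sigma^2_0$, and let $\mathbf n=(\mathbf n_1;\mathbf n_2)\in\mathbb Z_+^{m_1+1}\times\mathbb Z_+^{m_2+1}$, $|\mathbf n_1|=|\mathbf n_2|+1$. Let $\lambda_2$ and $S(\lambda_2)=\mathcal N(\rho^2_1,\ldots,\rho^2_{m_2})$ be a permutation of $(0,\ldots,m_2)$ and a Nikishin system associated with $\mathcal N(\sigma^2_1,\ldots,\sigma^2_{m_2})$ and $\mathbf n_2$ (in the sense defined in the context). Construct $(r^2_{0,0},\ldots,r^2_{0,m_2})=\mathcal N(\rho^2_0,\rho^2_1,\ldots,\rho^2_{m_2})$, where $d\rho^2_0=\widehat s^{\,2}_{1,\lambda_2(0)}\,d\sigma^2_0$ (with $\widehat s^{\,2}_{1,0}\equiv1$). Then the linear form $\mathcal A_{\mathbf n}$ satisfies $$\int x^\nu\mathcal A_{\mathbf n}(x)\,dr^2_{0,k}(x)=0,\qquad \nu=0,\ldots,n_{2,\lambda_2(k)}-1,\qquad k=0,\ldots,m_2.$$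
   Context: For a bounded interval $\Delta\subset\mathbb R$, $\mathcal M(\Delta)$ is the class of finite Borel measures $s$ of constant sign on $\mathbb R$ whose support is compact and infinite and such that $\Delta=\mathrm{Co}(\mathrm{supp}\,s)$ (convex hull). The Cauchy transform is $\widehat s(z)=\int\frac{ds(x)}{z-x}$. If $\Delta_\alpha\cap\Delta_\beta=\emptyset$, $\sigma_\alpha\in\mathcal M(\Delta_\alpha)$, $\sigma_\beta\in\mathcal M(\Delta_\beta)$, then $d\langle\sigma_\alpha,\sigma_\beta\rangle(x)=\widehat\sigma_\beta(x)\,d\sigma_\alpha(x)$. Nikishin system: given $\sigma_j\in\mathcal M(\Delta_j)$, $j=a,\ldots,b$, with $\Delta_j\cap\Delta_{j+1}=\emptyset$ for consecutive $j$, put $s_{j,j}=\sigma_j$, $s_{j,k}=\langle\sigma_j,\ldots,\sigma_k\rangle=\langle\sigma_j,\langle\sigma_{j+1},\ldots,\sigma_k\rangle\rangle$ for $j<k$; then $\mathcal N(\sigma_a,\ldots,\sigma_b)=(s_{a,a},\ldots,s_{a,b})$. Superscripts $1,2$ are indices; $s^i_{j,k}$ are built from the $\sigma^i_j$ and $r^2_{j,k}$ from the $\rho^2_j$. Mixed type linear form: let $\mathbb U=(1,\widehat s^{\,2}_{1,1},\ldots,\widehat s^{\,2}_{1,m_2})$, $\mathbb V=(1,\widehat s^{\,1}_{1,1},\ldots,\widehat s^{\,1}_{1,m_1})$, $\mathbb W=\mathbb U^t\mathbb V$, $\widehat{\mathbb S}(z)=\int\frac{\mathbb W(x)d\sigma^2_0(x)}{z-x}$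 (entrywise). For $\mathbf n=(\mathbf n_1;\mathbf n_2)$, $\mathbf n_i=(n_{i,0},\ldots,n_{i,m_i})$, $|\mathbf n_i|=\sum_jn_{i,j}$, $|\mathbf n_1|=|\mathbf n_2|+1$, let $\mathbb A_{\mathbf n}=(a_{\mathbf n,0},\ldots,a_{\mathbf n,m_1})\not\equiv\mathbf0$ be a vector of polynomials, $\deg a_{\mathbf n,k}\le n_{1,k}-1$ ($\deg\le-1$ means $\equiv 0$), such that for some vector polynomial $\mathbb D_{\mathbf n}$ the $j$-th component of $\widehat{\mathbb S}\mathbb A_{\mathbf n}^t-\mathbb D_{\mathbf n}^t$ is $\mathcal O(1/z^{n_{2,j}+1})$, $z\to\infty$, $j=0,\ldots,m_2$. Such $\mathbb A_{\mathbf n}$ exists and is unique up to a constant factor. Define $\mathcal A_{\mathbf n}=a_{\mathbf n,0}+\sum_{k=1}^{m_1}a_{\mathbf n,k}\widehat s^{\,1}_{1,k}$. Association: a permutation $\lambda$ of $(0,\ldots,m)$ and a Nikishin system $S(\lambda)=(r_{1,1},\ldots,r_{1,m})=\mathcal N(\rho_1,\ldots,\rho_m)$ are associated with $(s_{1,1},\ldots,s_{1,m})=\mathcal N(\sigma_1,\ldots,\sigma_m)$ and $(n_0,\ldots,n_m)\in\mathbb Z_+^{m+1}$ if $n_{\lambda(0)}\ge\cdots\ge n_{\lambda(m)}$ and for any real polynomials $p_k$, $\deg p_k\le n_k-1$, there exist real polynomials $q_k$, $\deg q_k\le n_{\lambda(k)}-1$, $k=0,\ldots,m$, such that $p_0+\sum_{k=1}^mp_k\widehat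 s_{1,k}=(q_0+\sum_{k=1}^mq_k\widehat r_{1,k})\widehat s_{1,\lambda(0)}$, with $\widehat s_{1,0}\equiv1$ (identity of analytic functions off the convex hulls of the supports). Such a pair always exists. In addition, $\mathrm{Co}(\mathrm{supp}\,\rho^2_1)$ is taken disjoint from $\mathrm{Co}(\mathrm{supp}\,\sigma^2_0)$, so that $\mathcal N(\rho^2_0,\ldots,\rho^2_{m_2})$ is defined. *)

theory Defs
  imports
    "HOL-Analysis.Analysis"
    "HOL-Computational_Algebra.Polynomial"
    "HOL-Combinatorics.Permutations"
    "HOL-Library.Landau_Symbols"
begin

definition msupport :: "real measure \<Rightarrow> real set" where
  "msupport M = {x. \<forall>U. open U \<longrightarrow> x \<in> U \<longrightarrow> emeasure M U > 0}"

text \<open>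
  A real measure of constant sign is a sign, $1$ or $-1$, together with a positive measure; the
  conditions are imposed in \<open>class_M\<close> below. For a measure with nonempty support both are unique.
\<close>

datatype cs_measure = CS (sign: real) (base: "real measure")

definition cs_support :: "cs_measure \<Rightarrow> real set" where
  "cs_support s = msupport (base s)"

definition cs_hull :: "cs_measure \<Rightarrow> real set" where
  "cs_hull s = convex hull (cs_support s)"

definition cs_integral ::
  "cs_measure \<Rightarrow> (real \<Rightarrow> 'a) \<Rightarrow> 'a::{banach, second_countable_topology}" where
  "cs_integral s f = sign s *\<^sub>R integral\<^sup>L (base s) f"

text \<open>A compact set with infinitely many points has a nondegenerate compact interval as its convex
  hull, so \<open>class_M \<Delta>\<close> is empty unless \<open>\<Delta>\<close> is such an interval.\<close>

definition class_M :: "real set \<Rightarrow> cs_measure set" where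
  "class_M \<Delta> = {s. sign s \<in> {1, -1} \<and> sets (base s) = sets borel \<and> finite_measure (base s) \<and>
     compact (cs_support s) \<and> infinite (cs_support s) \<and> \<Delta> = cs_hull s}"

text \<open>The Cauchy transform, usable both at complex and at real arguments.\<close>

definition cauchy ::
  "cs_measure \<Rightarrow> 'a \<Rightarrow> 'a::{real_normed_field, banach, second_countable_topology}" where
  "cauchy s z = cs_integral s (\<lambda>x. 1 / (z - of_real x))"

text \<open>The measure $w\,ds$, for a weight \<open>w\<close> of constant sign on the support of \<open>s\<close>. It is only meant
  for such weights.\<close>

definition cs_density :: "cs_measure \<Rightarrow> (real \<Rightarrow> real) \<Rightarrow> cs_measure" where
  "cs_density s w =
     CS (if AE x in base s. 0 \<le> w x then sign s else - sign s)
        (density (base s) (\<lambda>x. ennreal \<bar>w x\<bar>))"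

text \<open>The product $\langle\sigma_\alpha,\sigma_\beta\rangle$; if the convex hulls of the supports
  are disjoint, then the Cauchy transform of \<open>\<beta>\<close> has constant sign on that of \<open>\<alpha>\<close>.\<close>

definition cs_bracket :: "cs_measure \<Rightarrow> cs_measure \<Rightarrow> cs_measure" where
  "cs_bracket \<alpha> \<beta> = cs_density \<alpha> (\<lambda>x. cauchy \<beta> x)"

text \<open>\<open>nik \<sigma> j k\<close> is $s_{j,k}=\langle\sigma_j,\ldots,\sigma_k\rangle$, for $j\le k$.\<close>

function nik :: "(nat \<Rightarrow> cs_measure) \<Rightarrow> nat \<Rightarrow> nat \<Rightarrow> cs_measure" where
  "nik \<sigma> j k = (if j < k then cs_bracket (\<sigma> j) (nik \<sigma> (Suc j) k) else \<sigma> j)"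
  by auto
termination by (relation "Wellfounded.measure (\<lambda>(\<sigma>, j, k). k - j)") auto

declare nik.simps [simp del]

text \<open>The measures \<open>\<sigma> a, \<dots>, \<sigma> b\<close> generate a Nikishin system, namely
  \<open>nik \<sigma> a a, \<dots>, nik \<sigma> a b\<close>. For \<open>b < a\<close> the system is empty.\<close>

definition generates_nikishin :: "(nat \<Rightarrow> cs_measure) \<Rightarrow> nat \<Rightarrow> nat \<Rightarrow> bool" where
  "generates_nikishin \<sigma> a b \<longleftrightarrow>
     (\<exists>\<Delta>. (\<forall>j\<in>{a..b}. \<sigma> j \<in> class_M (\<Delta> j)) \<and> (\<forall>j\<in>{a..<b}. \<Delta> j \<inter> \<Delta> (Suc j) = {}))"

text \<open>$\widehat s_{1,k}$, with the convention $\widehat s_{1,0}\equiv 1$.\<close>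

definition s_hat :: "(nat \<Rightarrow> cs_measure) \<Rightarrow> nat \<Rightarrow> 'a \<Rightarrow>
    'a::{real_normed_field, banach, second_countable_topology}" where
  "s_hat \<sigma> k z = (if k = 0 then 1 else cauchy (nik \<sigma> 1 k) z)"

text \<open>$p_0+\sum_{k=1}^m p_k\widehat s_{1,k}$\<close>

definition linear_form ::
  "nat \<Rightarrow> (nat \<Rightarrow> cs_measure) \<Rightarrow> (nat \<Rightarrow> complex poly) \<Rightarrow> complex \<Rightarrow> complex" where
  "linear_form m \<sigma> p z = poly (p 0) z + (\<Sum>k=1..m. poly (p k) z * s_hat \<sigma> k z)"

text \<open>$\deg p\le n-1$, where $\deg p\le -1$ means $p=0$ (in the library \<open>degree 0 = 0\<close>).\<close>

definition deg_lt :: "'a::zero poly \<Rightarrow> nat \<Rightarrow> bool" where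
  "deg_lt p n \<longleftrightarrow> p = 0 \<or> degree p < n"

text \<open>The permutation \<open>lam\<close> and the Nikishin system generated by \<open>\<rho> 1, \<dots>, \<rho> m\<close> are associated with the
  one generated by \<open>\<sigma> 1, \<dots>, \<sigma> m\<close> and with the multi-index \<open>n 0, \<dots>, n m\<close>.\<close>

definition associated :: "nat \<Rightarrow> (nat \<Rightarrow> nat) \<Rightarrow> (nat \<Rightarrow> cs_measure) \<Rightarrow>
    (nat \<Rightarrow> cs_measure) \<Rightarrow> (nat \<Rightarrow> nat) \<Rightarrow> bool" where
  "associated m lam \<rho> \<sigma> n \<longleftrightarrow>
     lam permutes {0..m} \<and> generates_nikishin \<rho> 1 m \<and>
     (\<forall>i j. i \<le> j \<longrightarrow> j \<le> m \<longrightarrow> n (lam j) \<le> n (lam i)) \<and>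
     (\<forall>p::nat \<Rightarrow> real poly. (\<forall>k\<le>m. deg_lt (p k) (n k)) \<longrightarrow>
        (\<exists>q::nat \<Rightarrow> real poly. (\<forall>k\<le>m. deg_lt (q k) (n (lam k))) \<and>
           (\<forall>z. z \<notin> complex_of_real ` (\<Union>k\<in>{1..m}. cs_hull (nik \<sigma> 1 k) \<union> cs_hull (nik \<rho> 1 k)) \<longrightarrow>
              linear_form m \<sigma> (\<lambda>k. map_poly of_real (p k)) z =
              linear_form m \<rho> (\<lambda>k. map_poly of_real (q k)) z * s_hat \<sigma> (lam 0) z)))"

text \<open>The entries of $\mathbb W=\mathbb U^t\mathbb V$ and of $\widehat{\mathbb S}$: the row index \<open>j\<close>
  belongs to the system \<open>\<sigma>2\<close>, the column index \<open>k\<close> to \<open>\<sigma>1\<close>.\<close>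

definition W_entry :: "(nat \<Rightarrow> cs_measure) \<Rightarrow> (nat \<Rightarrow> cs_measure) \<Rightarrow> nat \<Rightarrow> nat \<Rightarrow> real \<Rightarrow> real" where
  "W_entry \<sigma>1 \<sigma>2 j k x = s_hat \<sigma>2 j x * s_hat \<sigma>1 k x"

definition S_entry ::
  "(nat \<Rightarrow> cs_measure) \<Rightarrow> (nat \<Rightarrow> cs_measure) \<Rightarrow> nat \<Rightarrow> nat \<Rightarrow> complex \<Rightarrow> complex" where
  "S_entry \<sigma>1 \<sigma>2 j k z =
     cs_integral (\<sigma>2 0) (\<lambda>x. of_real (W_entry \<sigma>1 \<sigma>2 j k x) / (z - of_real x))"

text \<open>The vector \<open>a\<close> is an admissible $\mathbb A_{\mathbf n}$, which is unique up to a constant factor;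
  \<open>d\<close> is $\mathbb D_{\mathbf n}$.\<close>

definition mixed_type_vector :: "nat \<Rightarrow> nat \<Rightarrow> (nat \<Rightarrow> cs_measure) \<Rightarrow> (nat \<Rightarrow> cs_measure) \<Rightarrow>
    (nat \<Rightarrow> nat) \<Rightarrow> (nat \<Rightarrow> nat) \<Rightarrow> (nat \<Rightarrow> complex poly) \<Rightarrow> bool" where
  "mixed_type_vector m1 m2 \<sigma>1 \<sigma>2 n1 n2 a \<longleftrightarrow>
     (\<exists>k\<le>m1. a k \<noteq> 0) \<and> (\<forall>k\<le>m1. deg_lt (a k) (n1 k)) \<and>
     (\<exists>d::nat \<Rightarrow> complex poly. \<forall>j\<le>m2.
        (\<lambda>z. (\<Sum>k=0..m1. S_entry \<sigma>1 \<sigma>2 j k z * poly (a k) z) - poly (d j) z)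
          \<in> O[at_infinity](\<lambda>z. 1 / z ^ (n2 j + 1)))"

end

theory Submission
  imports Defs "HOL-Complex_Analysis.Conformal_Mappings" "HOL-Library.Function_Algebras"
begin

text \<open>
  Write \<open>A\<close> for the linear form. The order of the remainder at infinity in row \<open>j\<close> says that the
  measure $\widehat s^{\,2}_{1,j} A\,d\sigma_0$ has vanishing moments of order below \<open>n2 j\<close>
  (\<open>moments_vanish_of_bigo\<close>). Hence \<open>A\<close> is orthogonal, with respect to $\sigma_0$, to every form
  $p_0 + \sum_k p_k \widehat s^{\,2}_{1,k}$ with real polynomials $p_k$ of degree below \<open>n2 k\<close>.

  The measure $r^2_{0,k}$ has the density
  $\widehat r^{\,2}_{1,k}\,\widehat s^{\,2}_{1,\lambda(0)}$ with respect to $\sigma_0$, where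
  $\widehat r^{\,2}_{1,0}\equiv 1$; so the claim is that \<open>A\<close> is orthogonal to
  $x^\nu\,\widehat r^{\,2}_{1,k}\,\widehat s^{\,2}_{1,\lambda(0)}$ for
  $\nu$ below \<open>n2 (lam k)\<close>. These functions are again forms of the above kind. Association gives this
  in the wrong direction: it embeds the space of the forms in $\widehat s^{\,2}_{1,k}$ in the span of
  the functions $x^\nu\,\widehat r^{\,2}_{1,k}\,\widehat s^{\,2}_{1,\lambda(0)}$. But both spaces have
  $|\mathbf n_2|$ generators, since $\lambda$ is a permutation, and on the side of
  $\widehat s^{\,2}_{1,k}$ these generators are independent. So the embedding is onto
  (\<open>associated_expansion\<close>).

  The independence is that of a Nikishin system over the polynomials (\<open>nikishin_independent\<close>). It
  rests on the same correspondence between moments and behaviour at infinity: a form that vanishes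
  near infinity has a density with vanishing moments of every order, which must be zero on the
  support, and this density is the corresponding form for a shorter Nikishin system.
\<close>

section \<open>Measures carried by a compact interval\<close>

text \<open>
  The complement of the support is a union of open null sets, and by the Lindelof property countably
  many of them suffice.
\<close>

lemma AE_msupport:
  assumes "sets M = sets borel"
  shows "AE x in M. x \<in> msupport M"
proof -
  define F where "F = {U. open U \<and> emeasure M U = 0}"
  obtain F' where F': "F' \<subseteq> F" "countable F'" "\<Union>F' = \<Union>F"
    using Lindelof[of F] unfolding F_def by auto
  have "F' \<subseteq> null_sets M"
    using F'(1) assms by (auto simp: F_def null_sets_def)
  then have "\<Union>F' \<in> null_sets M"
    using null_sets_UN'[OF F'(2), of "\<lambda>U. U" M] by auto
  then show ?thesis
    by (rule AE_I') (auto simp: F'(3) F_def msupport_def not_gr_zero)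
qed

text \<open>
  The part of membership in \<open>class_M\<close> that a weight of constant sign preserves for free: the
  support of the product need not be shown to be infinite, and \<open>K\<close> may be larger than its convex
  hull.
\<close>

definition carried_by :: "cs_measure \<Rightarrow> real set \<Rightarrow> bool" where
  "carried_by s K \<longleftrightarrow> sign s \<in> {1, -1} \<and> sets (base s) = sets borel \<and> finite_measure (base s) \<and>
     compact K \<and> convex K \<and> (AE x in base s. x \<in> K)"

lemma carried_byD:
  assumes "carried_by s K"
  shows "sign s \<in> {1, -1}" "sets (base s) = sets borel" "finite_measure (base s)"
    "compact K" "convex K" "AE x in base s. x \<in> K"
  using assms by (auto simp: carried_by_def)

lemma class_M_carried_by:
  assumes "s \<in> class_M \<Delta>"
  shows "carried_by s \<Delta>" "\<Delta> = cs_hull s"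
proof -
  have "AE x in base s. x \<in> msupport (base s)"
    using assms by (intro AE_msupport) (auto simp: class_M_def)
  then have "AE x in base s. x \<in> \<Delta>"
    by eventually_elim (use assms in \<open>auto simp: class_M_def cs_hull_def cs_support_def hull_inc\<close>)
  then show "carried_by s \<Delta>" "\<Delta> = cs_hull s"
    using assms by (auto simp: class_M_def carried_by_def cs_hull_def compact_convex_hull)
qed

lemma carried_by_hull_subset:
  assumes "carried_by s K"
  shows "cs_hull s \<subseteq> K"
  unfolding cs_hull_def
proof (rule hull_minimal)
  show "cs_support s \<subseteq> K"
  proof
    fix x assume x: "x \<in> cs_support s"
    show "x \<in> K"
    proof (rule ccontr)
      assume "x \<notin> K"
      moreover have "open (- K)"
        using assms by (simp add: carried_by_def compact_imp_closed open_Compl)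
      ultimately have "emeasure (base s) (- K) > 0"
        using x by (auto simp: cs_support_def msupport_def)
      moreover have "emeasure (base s) (- K) = 0"
      proof -
        have "{y \<in> space (base s). \<not> y \<in> K} = - K"
          using sets_eq_imp_space_eq[OF carried_byD(2)[OF assms]] by auto
        then show ?thesis
          using AE_E2[OF carried_byD(6)[OF assms]] \<open>open (- K)\<close> carried_byD(2)[OF assms]
          by (auto)
      qed
      ultimately show False by simp
    qed
  qed
  show "convex K" using assms by (simp add: carried_by_def)
qed

lemma carried_by_integrable:
  fixes f :: "real \<Rightarrow> 'a::{banach, second_countable_topology}"
  assumes "carried_by s K" and "f \<in> borel_measurable borel" and "continuous_on K f"
  shows "integrable (base s) f"
proof -
  interpret finite_measure "base s" using assms by (simp add: carried_by_def)
  have "bounded (f ` K)"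
    using assms by (auto simp: carried_by_def compact_imp_bounded compact_continuous_image)
  then obtain B where "\<And>x. x \<in> K \<Longrightarrow> norm (f x) \<le> B"
    by (auto simp: bounded_iff)
  moreover have "f \<in> borel_measurable (base s)"
    using assms measurable_cong_sets[OF carried_byD(2)[OF assms(1)] refl, of borel] by auto
  ultimately show ?thesis
    using carried_byD(6)[OF assms(1)] by (intro integrable_const_bound[where B=B]) (auto elim: AE_mp)
qed

text \<open>
  The sign chosen in \<open>cs_density\<close> makes the measure integrate like the signed density \<open>w\<close>: the
  factor \<open>c\<close> below satisfies \<open>\<bar>w\<bar> = c w\<close> almost everywhere and \<open>c\<^sup>2 = 1\<close>. If \<open>w\<close> vanishes almost
  everywhere, the choice is arbitrary, and harmless because the measure is zero.
\<close>

lemma carried_by_density: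
  fixes f :: "real \<Rightarrow> 'a::{banach, second_countable_topology}"
  assumes "carried_by s K" and w: "w \<in> borel_measurable borel" "continuous_on K w"
    and sgn: "(\<forall>x\<in>K. 0 \<le> w x) \<or> (\<forall>x\<in>K. w x \<le> 0)"
  shows "carried_by (cs_density s w) K"
    and "f \<in> borel_measurable borel \<Longrightarrow>
      cs_integral (cs_density s w) f = cs_integral s (\<lambda>x. w x *\<^sub>R f x)"
proof -
  note D = carried_byD[OF assms(1)]
  have meas: "\<And>g::real \<Rightarrow> 'c::{banach, second_countable_topology}.
     g \<in> borel_measurable borel \<Longrightarrow> g \<in> borel_measurable (base s)"
    using measurable_cong_sets[OF D(2) refl, of borel] by auto
  define c where "c = (if AE x in base s. 0 \<le> w x then 1 else - 1 :: real)"
  have c: "AE x in base s. \<bar>w x\<bar> = c * w x"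
  proof (cases "AE x in base s. 0 \<le> w x")
    case True
    then show ?thesis by eventually_elim (use True in \<open>auto simp: c_def\<close>)
  next
    case False
    then have "\<forall>x\<in>K. w x \<le> 0"
      using sgn D(6) by (metis (mono_tags, lifting) AE_mp AE_I2)
    then show ?thesis using D(6) False by (auto simp: c_def elim!: AE_mp)
  qed
  have base_density [simp]: "base (cs_density s w) = density (base s) (\<lambda>x. ennreal \<bar>w x\<bar>)"
    and [simp]: "sign (cs_density s w) = c * sign s"
    by (auto simp: cs_density_def c_def)
  have wm: "(\<lambda>x. \<bar>w x\<bar>) \<in> borel_measurable (base s)" using w by (intro meas) auto
  have wi: "integrable (base s) (\<lambda>x. \<bar>w x\<bar>)"
    using w by (intro carried_by_integrable[OF assms(1)] continuous_intros) auto
  have "finite_measure (density (base s) (\<lambda>x. ennreal \<bar>w x\<bar>))"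
    using wi wm by (intro finite_measureI)
      (auto simp: emeasure_density nn_integral_set_ennreal integrable_iff_bounded top.not_eq_extremum
         intro!: order.strict_implies_not_eq)
  moreover have "AE x in density (base s) (\<lambda>x. ennreal \<bar>w x\<bar>). x \<in> K"
    using wm D(6) by (subst AE_density) (auto elim: eventually_mono)
  ultimately show "carried_by (cs_density s w) K"
    using D unfolding carried_by_def base_density by (auto simp: c_def)
  {
    assume f: "f \<in> borel_measurable borel"
    note fm = meas[OF f]
    have ae: "AE x in base s. \<bar>w x\<bar> *\<^sub>R f x = c *\<^sub>R (w x *\<^sub>R f x)"
      using c by eventually_elim auto
    have m1: "(\<lambda>x. \<bar>w x\<bar> *\<^sub>R f x) \<in> borel_measurable (base s)"
         "(\<lambda>x. c *\<^sub>R (w x *\<^sub>R f x)) \<in> borel_measurable (base s)"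
      using f w by (auto intro!: meas)
    have "cs_integral (cs_density s w) f = (c * sign s) *\<^sub>R (\<integral>x. \<bar>w x\<bar> *\<^sub>R f x \<partial>base s)"
      unfolding cs_integral_def using fm wm by (simp add: integral_density)
    also have "(\<integral>x. \<bar>w x\<bar> *\<^sub>R f x \<partial>base s) = (\<integral>x. c *\<^sub>R (w x *\<^sub>R f x) \<partial>base s)"
      by (rule integral_cong_AE[OF m1 ae])
    also have "(c * sign s) *\<^sub>R (\<integral>x. c *\<^sub>R (w x *\<^sub>R f x) \<partial>base s) =
        (c * c * sign s) *\<^sub>R (\<integral>x. w x *\<^sub>R f x \<partial>base s)"
      by (subst integral_scaleR_right) (simp add: mult_ac)
    finally show "cs_integral (cs_density s w) f = cs_integral s (\<lambda>x. w x *\<^sub>R f x)"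
      by (simp add: cs_integral_def c_def)
  }
qed

section \<open>Cauchy transforms\<close>

lemma borel_measurable_cauchy:
  assumes "carried_by s K"
  shows "(cauchy s :: 'a \<Rightarrow> 'a::{real_normed_field, banach, second_countable_topology})
     \<in> borel_measurable borel"
proof -
  interpret finite_measure "base s" using assms by (simp add: carried_by_def)
  have [measurable_cong]: "sets (base s) = sets borel" using assms by (simp add: carried_by_def)
  have [measurable]: "(of_real :: real \<Rightarrow> 'a) \<in> borel_measurable borel"
    by (intro borel_measurable_continuous_onI continuous_intros)
  show ?thesis
    unfolding cauchy_def cs_integral_def by measurable
qed

lemma cauchy_of_real: "cauchy s (of_real x :: complex) = of_real (cauchy s x)"
proof -
  have "(\<integral>t. 1 / (complex_of_real x - of_real t) \<partial>base s) = of_real (\<integral>t. 1 / (x - t) \<partial>base s)"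
    by (subst integral_complex_of_real[symmetric]) simp
  then show ?thesis
    unfolding cauchy_def cs_integral_def by (simp add: scaleR_conv_of_real)
qed

text \<open>
  Two disjoint convex sets on the line lie on different sides of a point, so \<open>1 / (x - t)\<close> keeps one
  sign for \<open>x \<in> A\<close> and \<open>t \<in> K\<close>.
\<close>

lemma cauchy_constant_sign:
  assumes "carried_by s K" and "convex A" and "A \<inter> K = {}"
  shows "(\<forall>x\<in>A. 0 \<le> cauchy s (x::real)) \<or> (\<forall>x\<in>A. cauchy s x \<le> 0)"
proof (cases "A = {} \<or> K = {}")
  case True
  then show ?thesis
  proof
    assume "K = {}"
    then have "AE x in base s. False"
      using carried_byD(6)[OF assms(1)] by auto
    then have "cauchy s x = 0" for x :: real
      unfolding cauchy_def cs_integral_def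
      by (intro scaleR_eq_0_iff[THEN iffD2] disjI2 integral_eq_zero_AE) auto
    then show ?thesis by simp
  qed auto
next
  case False
  then obtain a b where ab: "a \<noteq> 0" "\<forall>x\<in>A. a * x \<le> b" "\<forall>t\<in>K. a * t \<ge> b"
    using separating_hyperplane_sets[of A K] assms carried_byD(5)[OF assms(1)] by (auto simp: inner_real_def)
  have "0 \<le> cauchy s x * (- a * sign s)" if "x \<in> A" for x
  proof -
    have pos: "0 \<le> (1 / (x - t)) * (- a)" if "t \<in> K" for t
    proof -
      have "a * (x - t) \<le> 0" using ab \<open>x \<in> A\<close> \<open>t \<in> K\<close> by (force simp: algebra_simps)
      then show ?thesis by (auto simp: divide_simps mult_le_0_iff)
    qed
    have "0 \<le> (\<integral>t. (1 / (x - t)) * (- a) \<partial>base s)"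
      using carried_byD(6)[OF assms(1)] by (intro integral_nonneg_AE) (rule AE_mp, assumption, rule AE_I2, rule impI, rule pos)
    also have "\<dots> = (\<integral>t. 1 / (x - t) \<partial>base s) * (- a)"
      by (rule integral_mult_left_zero)
    finally show ?thesis
      using carried_byD(1)[OF assms(1)] by (auto simp: cauchy_def cs_integral_def)
  qed
  then show ?thesis
    using \<open>a \<noteq> 0\<close> carried_byD(1)[OF assms(1)] 
    by (cases "a > 0") (fastforce simp: zero_le_mult_iff mult_le_0_iff)+
qed

text \<open>
  The difference quotient of \<open>1 / (z - x)\<close> is \<open>- 1 / ((w - x) (z - x))\<close>, which is bounded uniformly
  in \<open>x \<in> K\<close> when \<open>w\<close> is near \<open>z\<close>; so the limit may be taken under the integral.
\<close>

lemma holomorphic_cauchy: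
  assumes "carried_by s K"
  shows "cauchy s holomorphic_on (- complex_of_real ` K)"
proof -
  note D = carried_byD[OF assms]
  interpret finite_measure "base s" by (rule D)
  have [measurable_cong]: "sets (base s) = sets borel" by (rule D)
  have cl: "closed (complex_of_real ` K)"
    using D by (intro compact_imp_closed compact_continuous_image continuous_intros) 
  let ?C = "\<lambda>z. \<integral>x. 1 / (z - complex_of_real x) \<partial>base s"
  have "(?C has_field_derivative (\<integral>x. - (1 / (z - of_real x)^2) \<partial>base s)) (at z)"
    if z: "z \<notin> complex_of_real ` K" for z
  proof -
    obtain e where e: "e > 0" "ball z (2*e) \<subseteq> - complex_of_real ` K"
      using z cl by (metis ComplI open_Compl open_contains_ball field_sum_of_halves mult_2 half_gt_zero)
    have lower: "norm (w - of_real x) \<ge> e" if "w \<in> ball z e" "x \<in> K" for w x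
    proof (rule ccontr)
      assume "\<not> ?thesis"
      then have "dist z (complex_of_real x) < 2*e"
        using that dist_triangle[of z "complex_of_real x" w] by (auto simp: dist_norm)
      then show False using e that by auto
    qed
    have ae: "AE x in base s. \<forall>w\<in>ball z e. norm (w - complex_of_real x) \<ge> e"
      using D(6) by eventually_elim (use lower in auto)
    have int: "integrable (base s) (\<lambda>x. 1 / (w - complex_of_real x))" if "w \<in> ball z e" for w
      using that ae e by (intro integrable_const_bound[where B="1/e"])
        (auto simp: norm_divide divide_simps mult.commute elim!: eventually_mono)
    have "((\<lambda>w. \<integral>x. - (1 / ((w - of_real x) * (z - of_real x))) \<partial>base s) \<longlongrightarrow>
        (\<integral>x. - (1 / ((z - of_real x) * (z - of_real x))) \<partial>base s)) (at z)"
    proof (rule tendsto_at_iff_sequentially[THEN iffD2, rule_format], unfold o_def)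
      fix X :: "nat \<Rightarrow> complex"
      assume X: "\<And>i. X i \<in> UNIV - {z}" "X \<longlonglongrightarrow> z"
      have evX: "\<forall>\<^sub>F i in sequentially. X i \<in> ball z e"
        using tendstoD[OF X(2) e(1)] by (simp add: dist_commute)
      then obtain N where N: "\<And>i. i \<ge> N \<Longrightarrow> X i \<in> ball z e"
        by (auto simp: eventually_sequentially)
      have "(\<lambda>i. \<integral>x. - (1 / ((X (i+N) - of_real x) * (z - of_real x))) \<partial>base s) \<longlonglongrightarrow>
        (\<integral>x. - (1 / ((z - of_real x) * (z - of_real x))) \<partial>base s)"
      proof (rule integral_dominated_convergence[where w="\<lambda>_. 1/(e*e)"])
        show "AE x in base s. (\<lambda>i. - (1 / ((X (i+N) - of_real x) * (z - of_real x)))) \<longlonglongrightarrow>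
           - (1 / ((z - complex_of_real x) * (z - of_real x)))"
          using D(6)
        proof eventually_elim
          case (elim x)
          then have "z \<noteq> of_real x" using z by auto
          then show ?case
            using LIMSEQ_ignore_initial_segment[OF X(2), of N] by (intro tendsto_intros) auto
        qed
        show "AE x in base s. norm (- (1 / ((X (i+N) - of_real x) * (z - complex_of_real x)))) \<le> 1/(e*e)" for i
          using ae
        proof eventually_elim
          case (elim x)
          have "e \<le> norm (X (i+N) - of_real x)" "e \<le> norm (z - of_real x)"
            using elim N[of "i+N"] e by auto
          then show ?case
            using e by (auto simp: norm_divide norm_mult intro!: divide_left_mono mult_mono mult_pos_pos)
        qed
      qed auto
      then show "(\<lambda>i. \<integral>x. - (1 / ((X i - of_real x) * (z - of_real x))) \<partial>base s) \<longlonglongrightarrow>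
        (\<integral>x. - (1 / ((z - of_real x) * (z - of_real x))) \<partial>base s)"
        by (rule LIMSEQ_offset)
    qed
    moreover have "\<forall>\<^sub>F w in at z. (\<integral>x. - (1 / ((w - of_real x) * (z - of_real x))) \<partial>base s) =
        (?C w - ?C z) / (w - z)"
    proof -
      have "\<forall>\<^sub>F w in at z. w \<in> ball z e \<and> w \<noteq> z"
        using e(1) by (auto simp: eventually_at dist_commute intro!: exI[of _ e])
      then show ?thesis
      proof eventually_elim
        case (elim w)
        have "?C w - ?C z = (\<integral>x. 1 / (w - of_real x) - 1 / (z - complex_of_real x) \<partial>base s)"
          using elim e by (subst Bochner_Integration.integral_diff) (auto intro!: int)
        also have "\<dots> = (\<integral>x. (w - z) * - (1 / ((w - of_real x) * (z - complex_of_real x))) \<partial>base s)"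
        proof (rule integral_cong_AE)
          show "AE x in base s. 1 / (w - of_real x) - 1 / (z - complex_of_real x) =
              (w - z) * - (1 / ((w - of_real x) * (z - complex_of_real x)))"
            using ae
          proof eventually_elim
            case (elim x)
            have "z \<in> ball z e" "w \<in> ball z e"
              using e \<open>w \<in> ball z e \<and> w \<noteq> z\<close> by auto
            then have "e \<le> norm (w - of_real x)" "e \<le> norm (z - of_real x)"
              using elim by blast+
            then have "w - of_real x \<noteq> 0" "z - of_real x \<noteq> 0"
              using e by auto
            then show ?case by (simp add: divide_simps)
          qed
        qed auto
        also have "\<dots> = (w - z) * (\<integral>x. - (1 / ((w - of_real x) * (z - complex_of_real x))) \<partial>base s)"
          by (rule integral_mult_right_zero)
        finally show ?case using elim by simp
      qed
    qed
    ultimately show ?thesis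
      unfolding has_field_derivative_iff
      by (auto simp: power2_eq_square intro: Lim_transform_eventually)
  qed
  then have "?C holomorphic_on (- complex_of_real ` K)"
    unfolding holomorphic_on_def field_differentiable_def
    by (auto intro: has_field_derivative_at_within)
  then have "(\<lambda>z. of_real (sign s) * ?C z) holomorphic_on (- complex_of_real ` K)"
    by (intro holomorphic_intros)
  then show ?thesis
    by (simp add: cauchy_def[abs_def] cs_integral_def scaleR_conv_of_real)
qed

lemma continuous_on_cauchy:
  assumes "carried_by s K" and "A \<inter> K = {}"
  shows "continuous_on A (cauchy s :: real \<Rightarrow> real)"
proof -
  have "continuous_on A (\<lambda>x. Re (cauchy s (complex_of_real x)))"
    using assms(2) by (intro continuous_intros continuous_on_compose2[OF
       holomorphic_on_imp_continuous_on[OF holomorphic_cauchy[OF assms(1)]]]) auto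
  then show ?thesis by (simp add: cauchy_of_real)
qed

lemma carried_by_bracket:
  fixes f :: "real \<Rightarrow> 'a::{banach, second_countable_topology}"
  assumes "carried_by s K" "carried_by t L" "K \<inter> L = {}"
  shows "carried_by (cs_bracket s t) K"
    and "f \<in> borel_measurable borel \<Longrightarrow>
      cs_integral (cs_bracket s t) f = cs_integral s (\<lambda>x. cauchy t x *\<^sub>R f x)"
  unfolding cs_bracket_def
  by (intro carried_by_density[OF assms(1)] borel_measurable_cauchy[OF assms(2)]
       continuous_on_cauchy[OF assms(2,3)]
       cauchy_constant_sign[OF assms(2) carried_byD(5)[OF assms(1)] assms(3)]; assumption)+

lemma carried_by_nik:
  assumes "\<And>i. i \<in> {j..k} \<Longrightarrow> carried_by (\<sigma> i) (\<Delta> i)"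
    and "\<And>i. i \<in> {j..<k} \<Longrightarrow> \<Delta> i \<inter> \<Delta> (Suc i) = {}" and "j \<le> k"
  shows "carried_by (nik \<sigma> j k) (\<Delta> j)"
  using assms
proof (induction "k - j" arbitrary: j)
  case 0
  then show ?case by (subst nik.simps) auto
next
  case (Suc n)
  have "carried_by (nik \<sigma> (Suc j) k) (\<Delta> (Suc j))"
    using Suc by (intro Suc.hyps) auto
  then have "carried_by (cs_bracket (\<sigma> j) (nik \<sigma> (Suc j) k)) (\<Delta> j)"
    using Suc.hyps(2) Suc.prems by (intro carried_by_bracket(1)[of _ _ _ "\<Delta> (Suc j)"]) auto
  then show ?case
    using Suc.hyps(2) by (subst nik.simps) auto
qed

section \<open>Moments and the behaviour of Cauchy transforms at infinity\<close>

lemma poly_tendsto_0_imp_eq_0: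
  fixes p :: "complex poly"
  assumes "(poly p \<longlongrightarrow> 0) at_infinity"
  shows "p = 0"
proof (cases "degree p > 0")
  case True
  then show ?thesis
    using assms filterlim_poly_at_infinity[OF True] not_tendsto_and_filterlim_at_infinity[of at_infinity "poly p"]
    by (auto simp: trivial_limit_at_infinity)
next
  case False
  then obtain c where c: "p = [:c:]" by (auto elim: degree_eq_zeroE)
  moreover have "poly [:c:] = (\<lambda>_. c)" by auto
  ultimately have "((\<lambda>_::complex. c) \<longlongrightarrow> 0) at_infinity" using assms by simp
  then show ?thesis by (simp add: c tendsto_const_iff trivial_limit_at_infinity)
qed

lemma tendsto_integral_div_at_infinity:
  fixes \<phi> :: "real \<Rightarrow> complex"
  assumes "carried_by s K" "\<phi> \<in> borel_measurable borel" "continuous_on K \<phi>"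
  shows "((\<lambda>z. \<integral>x. \<phi> x / (z - of_real x) \<partial>base s) \<longlongrightarrow> 0) at_infinity"
proof -
  note D = carried_byD[OF assms(1)]
  obtain R where R: "\<And>x. x \<in> K \<Longrightarrow> \<bar>x\<bar> \<le> R"
    using compact_imp_bounded[OF D(4)] by (auto simp: bounded_iff)
  define C where "C = (\<integral>x. norm (\<phi> x) \<partial>base s)"
  have int: "integrable (base s) (\<lambda>x. norm (\<phi> x))"
    by (intro carried_by_integrable[OF assms(1)] continuous_intros assms(3) borel_measurable_norm
        measurable_compose[OF assms(2) borel_measurable_norm])
  have "norm (\<integral>x. \<phi> x / (z - of_real x) \<partial>base s) \<le> C / (norm z - R)" if z: "norm z > R" for z
  proof -
    have bound: "norm (\<phi> x / (z - of_real x)) \<le> norm (\<phi> x) / (norm z - R)" if "x \<in> K" for x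
    proof -
      have "norm z - R \<le> norm (z - of_real x)"
        using norm_triangle_ineq2[of z "of_real x"] R[OF that] by simp
      then show ?thesis using z by (auto simp: norm_divide intro!: divide_left_mono mult_pos_pos)
    qed
    have "norm (\<integral>x. \<phi> x / (z - of_real x) \<partial>base s) \<le> (\<integral>x. norm (\<phi> x / (z - of_real x)) \<partial>base s)"
      by (rule integral_norm_bound)
    also have "\<dots> \<le> (\<integral>x. norm (\<phi> x) / (norm z - R) \<partial>base s)"
      using D(6) int z by (intro integral_mono_AE') (auto elim!: eventually_mono intro!: bound divide_nonneg_nonneg)
    also have "\<dots> = C / (norm z - R)" by (simp add: C_def)
    finally show ?thesis .
  qed
  then have "\<forall>\<^sub>F z in at_infinity. norm (\<integral>x. \<phi> x / (z - of_real x) \<partial>base s) \<le> C / (norm z - R)"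
    by (auto simp: eventually_at_infinity intro!: exI[of _ "R + 1"])
  moreover have "((\<lambda>z::complex. C / (norm z - R)) \<longlongrightarrow> 0) at_infinity"
    by (intro tendsto_divide_0[OF tendsto_const] filterlim_at_top_imp_at_infinity)
      (use filterlim_tendsto_add_at_top[OF tendsto_const filterlim_norm_at_top, of "-R"] in \<open>simp add: algebra_simps\<close>)
  ultimately show ?thesis
    by (rule Lim_null_comparison)
qed

lemma borel_measurable_poly_of_real:
  "(\<lambda>x. poly p (of_real x :: complex)) \<in> borel_measurable borel"
  by (intro borel_measurable_continuous_onI continuous_intros)

text \<open>
  The error \<open>(p z - p x) / (z - x)\<close> is a polynomial in \<open>z\<close>, and integrating it against \<open>\<phi>\<close> leaves a
  polynomial. Horner's scheme makes this an induction, via \<open>z / (z - x) = 1 + x / (z - x)\<close>.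
\<close>

lemma poly_times_transform:
  fixes \<phi> :: "real \<Rightarrow> complex"
  assumes "carried_by s K" "\<phi> \<in> borel_measurable borel" "continuous_on K \<phi>"
  shows "\<exists>e. \<forall>z. z \<notin> of_real ` K \<longrightarrow>
     poly p z * (\<integral>x. \<phi> x / (z - of_real x) \<partial>base s) =
     (\<integral>x. poly p (of_real x) * \<phi> x / (z - of_real x) \<partial>base s) + poly e z"
proof (induction p)
  case 0
  then show ?case by (auto intro: exI[of _ 0])
next
  case (pCons c p)
  note [measurable] = assms(2) borel_measurable_poly_of_real
  note D = carried_byD[OF assms(1)]
  have [measurable_cong]: "sets (base s) = sets borel" by (rule D)
  obtain e where e: "\<And>z. z \<notin> of_real ` K \<Longrightarrow>
     poly p z * (\<integral>x. \<phi> x / (z - of_real x) \<partial>base s) =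
     (\<integral>x. poly p (of_real x) * \<phi> x / (z - of_real x) \<partial>base s) + poly e z"
    using pCons.IH by auto
  define m where "m = (\<integral>x. poly p (of_real x) * \<phi> x \<partial>base s)"
  have "poly (pCons c p) z * (\<integral>x. \<phi> x / (z - of_real x) \<partial>base s) =
     (\<integral>x. poly (pCons c p) (of_real x) * \<phi> x / (z - of_real x) \<partial>base s) + poly (pCons m e) z"
    if z: "z \<notin> of_real ` K" for z
  proof -
    have nz: "\<forall>x\<in>K. z - of_real x \<noteq> 0" using z by auto
    have int: "integrable (base s) (\<lambda>x. \<phi> x / (z - of_real x))"
      "integrable (base s) (\<lambda>x. poly p (of_real x) * \<phi> x / (z - of_real x))"
      "integrable (base s) (\<lambda>x. poly p (of_real x) * \<phi> x)"
      by (intro carried_by_integrable[OF assms(1)] continuous_intros assms nz; measurable)+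
    have "(\<integral>x. poly (pCons c p) (of_real x) * \<phi> x / (z - of_real x) \<partial>base s) =
       (\<integral>x. c * (\<phi> x / (z - of_real x)) + z * (poly p (of_real x) * \<phi> x / (z - of_real x))
          - poly p (of_real x) * \<phi> x \<partial>base s)"
    proof (rule integral_cong_AE)
      show "AE x in base s. poly (pCons c p) (of_real x) * \<phi> x / (z - of_real x) =
         c * (\<phi> x / (z - of_real x)) + z * (poly p (of_real x) * \<phi> x / (z - of_real x))
          - poly p (of_real x) * \<phi> x"
        using D(6) by eventually_elim (use nz in \<open>simp add: divide_simps, simp add: algebra_simps\<close>)
    qed measurable
    also have "\<dots> = c * (\<integral>x. \<phi> x / (z - of_real x) \<partial>base s)
        + z * (\<integral>x. poly p (of_real x) * \<phi> x / (z - of_real x) \<partial>base s) - m"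
      using int by (simp add: m_def del: times_divide_eq_right)
    finally show ?thesis
      using e[OF z] by (simp add: algebra_simps)
  qed
  then show ?case by blast
qed

lemma eventually_off_compact_at_infinity:
  assumes "compact K"
  shows "\<forall>\<^sub>F z in at_infinity. z \<notin> complex_of_real ` K"
proof -
  obtain R where "\<And>x. x \<in> K \<Longrightarrow> \<bar>x\<bar> \<le> R"
    using compact_imp_bounded[OF assms] by (auto simp: bounded_iff)
  then show ?thesis
    by (auto simp: eventually_at_infinity not_le intro!: exI[of _ "R + 1"]) fastforce
qed

text \<open>
  Moving the polynomials \<open>p k\<close> under the integral changes the form by a polynomial only, so up to a
  polynomial \<open>E\<close> it is the Cauchy transform of \<open>\<Phi> ds\<close>, where \<open>\<Phi> = \<Sum>k. p k * \<phi> k\<close>. The moments of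
  \<open>\<Phi> ds\<close> are the Laurent coefficients of that transform at infinity: multiplied by \<open>z\<^sup>N\<close>, it is
  \<open>\<Sum>i<N. m i * z ^ (N - 1 - i)\<close> plus the Cauchy transform of \<open>x\<^sup>N \<Phi> ds\<close>, which tends to zero. The
  growth condition then makes the polynomial \<open>Q\<close> below tend to zero, so it is zero, and since
  \<open>z\<^sup>N E\<close> only has coefficients of index at least \<open>N\<close>, the lower ones give the moments.
\<close>

lemma moments_vanish_of_bigo:
  fixes \<phi> :: "'i \<Rightarrow> real \<Rightarrow> complex"
  assumes s: "carried_by s K" and "finite I"
    and \<phi>: "\<And>k. k \<in> I \<Longrightarrow> \<phi> k \<in> borel_measurable borel"
      "\<And>k. k \<in> I \<Longrightarrow> continuous_on K (\<phi> k)"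
    and O: "(\<lambda>z. (\<Sum>k\<in>I. poly (p k) z * cs_integral s (\<lambda>x. \<phi> k x / (z - of_real x))) - poly d z)
       \<in> O[at_infinity](\<lambda>z. 1 / z ^ (N + 1))"
    and "\<nu> < N"
  shows "cs_integral s (\<lambda>x. of_real x ^ \<nu> * (\<Sum>k\<in>I. poly (p k) (of_real x) * \<phi> k x)) = 0"
proof -
  note D = carried_byD[OF s]
  have [measurable_cong]: "sets (base s) = sets borel" by (rule D)
  define \<Phi> where "\<Phi> x = (\<Sum>k\<in>I. poly (p k) (of_real x) * \<phi> k x)" for x
  have \<Phi>m [measurable]: "\<Phi> \<in> borel_measurable borel" unfolding \<Phi>_def
    using \<phi> borel_measurable_poly_of_real by (intro borel_measurable_sum borel_measurable_times) auto
  have \<Phi>c: "continuous_on K \<Phi>" unfolding \<Phi>_def by (intro continuous_intros \<phi>)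
  define c where "c = complex_of_real (sign s)"
  have c: "c \<noteq> 0" using D by (auto simp: c_def)
  have "\<forall>k\<in>I. \<exists>e. \<forall>z. z \<notin> of_real ` K \<longrightarrow>
     poly (p k) z * (\<integral>x. \<phi> k x / (z - of_real x) \<partial>base s) =
     (\<integral>x. poly (p k) (of_real x) * \<phi> k x / (z - of_real x) \<partial>base s) + poly e z"
    using poly_times_transform[OF s \<phi>] by auto
  from bchoice[OF this] obtain e where e: "\<forall>k\<in>I. \<forall>z. z \<notin> of_real ` K \<longrightarrow>
     poly (p k) z * (\<integral>x. \<phi> k x / (z - of_real x) \<partial>base s) =
     (\<integral>x. poly (p k) (of_real x) * \<phi> k x / (z - of_real x) \<partial>base s) + poly (e k) z" ..
  define E where "E = d - smult c (\<Sum>k\<in>I. e k)"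
  define m where "m i = (\<integral>x. of_real x ^ i * \<Phi> x \<partial>base s)" for i
  define G where "G z = (\<Sum>k\<in>I. poly (p k) z * cs_integral s (\<lambda>x. \<phi> k x / (z - of_real x))) - poly d z" for z
  define Q where "Q = smult c (\<Sum>i<N. monom (m i) (N - Suc i)) - monom 1 N * E"
  have Q: "poly Q z = z ^ N * G z - c * (\<integral>x. of_real x ^ N * \<Phi> x / (z - of_real x) \<partial>base s)"
    if z: "z \<notin> of_real ` K" for z
  proof -
    have nz: "\<forall>x\<in>K. z - of_real x \<noteq> 0" using z by auto
    have int: "integrable (base s) (\<lambda>x. poly (p k) (of_real x) * \<phi> k x / (z - of_real x))" if "k \<in> I" for k
      using that by (intro carried_by_integrable[OF s] continuous_intros \<phi> nz borel_measurable_divide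
          borel_measurable_times borel_measurable_poly_of_real borel_measurable_continuous_onI)
    have intm: "integrable (base s) (\<lambda>x. of_real x ^ i * \<Phi> x)" for i
      by (intro carried_by_integrable[OF s] continuous_intros \<Phi>c) measurable
    have intN: "integrable (base s) (\<lambda>x. of_real x ^ N * \<Phi> x / (z - of_real x))"
      by (intro carried_by_integrable[OF s] continuous_intros \<Phi>c nz) measurable
    have "(\<Sum>k\<in>I. poly (p k) z * cs_integral s (\<lambda>x. \<phi> k x / (z - of_real x))) =
        c * (\<Sum>k\<in>I. poly (p k) z * (\<integral>x. \<phi> k x / (z - of_real x) \<partial>base s))"
      by (simp add: cs_integral_def scaleR_conv_of_real sum_distrib_left mult_ac c_def)
    also have "(\<Sum>k\<in>I. poly (p k) z * (\<integral>x. \<phi> k x / (z - of_real x) \<partial>base s)) =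
        (\<Sum>k\<in>I. (\<integral>x. poly (p k) (of_real x) * \<phi> k x / (z - of_real x) \<partial>base s) + poly (e k) z)"
      using z by (intro sum.cong e[rule_format]) auto
    also have "\<dots> = (\<integral>x. \<Phi> x / (z - of_real x) \<partial>base s) + poly (\<Sum>k\<in>I. e k) z"
      using int by (simp add: \<Phi>_def sum_divide_distrib sum.distrib poly_sum Bochner_Integration.integral_sum)
    finally have G: "G z = c * (\<integral>x. \<Phi> x / (z - of_real x) \<partial>base s) - poly E z"
      by (simp add: G_def E_def algebra_simps)
    have "z ^ N * (\<integral>x. \<Phi> x / (z - of_real x) \<partial>base s) = (\<integral>x. z ^ N * (\<Phi> x / (z - of_real x)) \<partial>base s)"
      by (rule integral_mult_right_zero[symmetric])
    also have "\<dots> = (\<integral>x. of_real x ^ N * \<Phi> x / (z - of_real x)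
        + (\<Sum>i<N. z ^ (N - Suc i) * (of_real x ^ i * \<Phi> x)) \<partial>base s)"
    proof (rule integral_cong_AE)
      show "AE x in base s. z ^ N * (\<Phi> x / (z - of_real x)) = of_real x ^ N * \<Phi> x / (z - of_real x)
        + (\<Sum>i<N. z ^ (N - Suc i) * (of_real x ^ i * \<Phi> x))"
        using D(6)
      proof eventually_elim
        case (elim x)
        have "of_real x ^ N - z ^ N = (of_real x - z) * (\<Sum>i<N. z ^ (N - Suc i) * of_real x ^ i)"
          by (rule power_diff_sumr2)
        then have "z ^ N = of_real x ^ N + (z - of_real x) * (\<Sum>i<N. z ^ (N - Suc i) * of_real x ^ i)"
          by (simp add: algebra_simps)
        then have "z ^ N * (\<Phi> x / (z - of_real x)) = of_real x ^ N * \<Phi> x / (z - of_real x)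
          + (\<Sum>i<N. z ^ (N - Suc i) * of_real x ^ i) * \<Phi> x"
          using nz[rule_format, OF elim] by (simp add: divide_simps) (simp add: algebra_simps)
        then show ?case by (simp only: sum_distrib_right mult.assoc)
      qed
    qed measurable
    also have "\<dots> = (\<integral>x. of_real x ^ N * \<Phi> x / (z - of_real x) \<partial>base s) + (\<Sum>i<N. z ^ (N - Suc i) * m i)"
      using intN intm by (simp add: m_def Bochner_Integration.integral_sum)
    finally have "z ^ N * (\<integral>x. \<Phi> x / (z - of_real x) \<partial>base s) = \<dots>" .
    then have "c * (z ^ N * (\<integral>x. \<Phi> x / (z - of_real x) \<partial>base s)) =
      c * (\<integral>x. of_real x ^ N * \<Phi> x / (z - of_real x) \<partial>base s) + c * (\<Sum>i<N. z ^ (N - Suc i) * m i)"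
      by (simp add: distrib_left)
    then show ?thesis
      by (simp add: G Q_def poly_sum poly_monom algebra_simps)
  qed
  have "((\<lambda>z. z ^ N * G z) \<longlongrightarrow> 0) at_infinity"
  proof -
    have "(\<lambda>z. z ^ N * G z) \<in> O[at_infinity](\<lambda>z. z ^ N * (1 / z ^ (N + 1)))"
      using O unfolding G_def by (intro landau_o.big.mult) auto
    moreover have "(\<lambda>z::complex. z ^ N * (1 / z ^ (N + 1))) \<in> o[at_infinity](\<lambda>_. 1)"
    proof (rule smalloI_tendsto)
      have "((\<lambda>z::complex. inverse z) \<longlongrightarrow> 0) at_infinity"
        by (rule tendsto_inverse_0)
      moreover have "\<forall>\<^sub>F z in at_infinity. inverse z = z ^ N * (1 / z ^ (N + 1)) / (1::complex)"
        using eventually_not_equal_at_infinity[of 0]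
        by eventually_elim (simp add: field_simps)
      ultimately show "((\<lambda>z::complex. z ^ N * (1 / z ^ (N + 1)) / 1) \<longlongrightarrow> 0) at_infinity"
        by (rule Lim_transform_eventually)
    qed auto
    ultimately have "(\<lambda>z. z ^ N * G z) \<in> o[at_infinity](\<lambda>_. 1)"
      by (rule landau_o.big_small_trans)
    then show ?thesis by (auto dest: smalloD_tendsto)
  qed
  moreover have "((\<lambda>z. \<integral>x. of_real x ^ N * \<Phi> x / (z - of_real x) \<partial>base s) \<longlongrightarrow> 0) at_infinity"
    by (intro tendsto_integral_div_at_infinity[OF s] continuous_intros \<Phi>c) measurable
  ultimately have "((\<lambda>z. z ^ N * G z - c * (\<integral>x. of_real x ^ N * \<Phi> x / (z - of_real x) \<partial>base s)) \<longlongrightarrow> 0 - c * 0) at_infinity"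
    by (intro tendsto_intros)
  moreover have "\<forall>\<^sub>F z in at_infinity. z ^ N * G z - c * (\<integral>x. of_real x ^ N * \<Phi> x / (z - of_real x) \<partial>base s) = poly Q z"
    using eventually_off_compact_at_infinity[OF D(4)] by eventually_elim (simp add: Q)
  ultimately have "(poly Q \<longlongrightarrow> 0) at_infinity"
    using Lim_transform_eventually by fastforce
  then have "Q = 0" by (rule poly_tendsto_0_imp_eq_0)
  then have "coeff Q (N - Suc \<nu>) = 0" by simp
  moreover have "coeff Q (N - Suc \<nu>) = c * m \<nu>"
  proof -
    have "(\<Sum>i<N. coeff (monom (m i) (N - Suc i)) (N - Suc \<nu>)) = (\<Sum>i<N. if i = \<nu> then m i else 0)"
      using \<open>\<nu> < N\<close> by (intro sum.cong) auto
    then show ?thesis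
      using \<open>\<nu> < N\<close> by (simp add: Q_def coeff_sum coeff_monom_mult)
  qed
  ultimately show ?thesis
    using c by (simp add: m_def \<Phi>_def cs_integral_def)
qed

section \<open>Independence of a Nikishin system over the polynomials\<close>

text \<open>
  By the Weierstrass theorem \<open>g\<close> is a uniform limit of polynomials on \<open>K\<close>, all orthogonal to \<open>g\<close>;
  so \<open>\<integral> g\<^sup>2 = 0\<close>. A continuous function that vanishes almost everywhere vanishes on the support.
\<close>

lemma zero_on_support_of_moments_real:
  fixes g :: "real \<Rightarrow> real"
  assumes s: "carried_by s K" and g: "g \<in> borel_measurable borel" "continuous_on K g"
    and m: "\<And>n. (\<integral>x. x ^ n * g x \<partial>base s) = 0" and "x \<in> cs_support s"
  shows "g x = 0"
proof -
  note D = carried_byD[OF s]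
  have [measurable_cong]: "sets (base s) = sets borel" by (rule D)
  note [measurable] = g(1)
  have int: "integrable (base s) h" if "h \<in> borel_measurable borel" "continuous_on K h" for h :: "real \<Rightarrow> real"
    using that by (rule carried_by_integrable[OF s])
  define C where "C = (\<integral>x. \<bar>g x\<bar> \<partial>base s)"
  have C: "C \<ge> 0" by (simp add: C_def)
  have ig: "integrable (base s) (\<lambda>x. \<bar>g x\<bar>)" by (intro int continuous_intros g) measurable
  have ig2: "integrable (base s) (\<lambda>x. g x * g x)" by (intro int continuous_intros g) measurable
  have "(\<integral>x. g x * g x \<partial>base s) \<le> e" if "e > 0" for e
  proof -
    \<comment> \<open>adding 1 to the \<open>L\<^sup>1\<close> norm \<open>C\<close> of \<open>g\<close> covers the case \<open>C = 0\<close>\<close>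
    define d where "d = e / (C + 1)"
    have d: "d > 0" using C that by (simp add: d_def)
    obtain q where q: "real_polynomial_function q" "\<And>x. x \<in> K \<Longrightarrow> \<bar>g x - q x\<bar> < d"
      using Stone_Weierstrass_real_polynomial_function[OF D(4) g(2) d] by metis
    obtain a n where an: "q = (\<lambda>x. \<Sum>i\<le>n. a i * x ^ i)"
      using real_polynomial_function_imp_sum[OF q(1)] by blast
    have qm [measurable]: "q \<in> borel_measurable borel" by (simp add: an)
    have qc: "continuous_on K q" unfolding an by (intro continuous_intros)
    have iq: "integrable (base s) (\<lambda>x. q x * g x)" by (intro int continuous_intros g qc) measurable
    have im: "integrable (base s) (\<lambda>x. x ^ i * g x)" for i by (intro int continuous_intros g) measurable
    have "(\<integral>x. q x * g x \<partial>base s) = (\<integral>x. (\<Sum>i\<le>n. a i * (x ^ i * g x)) \<partial>base s)"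
      by (simp only: an sum_distrib_right mult.assoc)
    also have "\<dots> = 0"
      using im m by (simp add: Bochner_Integration.integral_sum)
    finally have "(\<integral>x. g x * g x \<partial>base s) = (\<integral>x. g x * g x - q x * g x \<partial>base s)"
      using iq ig2 by simp
    also have "\<dots> \<le> (\<integral>x. d * \<bar>g x\<bar> \<partial>base s)"
    proof (rule integral_mono_AE)
      show "AE x in base s. g x * g x - q x * g x \<le> d * \<bar>g x\<bar>"
        using D(6)
      proof eventually_elim
        case (elim x)
        have "g x * g x - q x * g x \<le> \<bar>g x - q x\<bar> * \<bar>g x\<bar>"
          by (simp add: abs_mult[symmetric] left_diff_distrib[symmetric])
        also have "\<dots> \<le> d * \<bar>g x\<bar>" using q(2)[OF elim] by (intro mult_right_mono) auto
        finally show ?case .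
      qed
    qed (use iq ig ig2 in auto)
    also have "\<dots> = d * C" by (simp add: C_def)
    also have "\<dots> \<le> e" using C that by (simp add: d_def field_simps)
    finally show ?thesis .
  qed
  then have "(\<integral>x. g x * g x \<partial>base s) \<le> 0" by (rule field_le_epsilon[of _ 0, simplified])
  moreover have "(\<integral>x. g x * g x \<partial>base s) \<ge> 0" by simp
  ultimately have ae: "AE x in base s. g x * g x = 0"
    using integral_nonneg_eq_0_iff_AE[OF ig2] by auto
  show ?thesis
  proof (rule ccontr)
    assume "g x \<noteq> 0"
    obtain U where U: "open U" "U \<inter> K = g -` (- {0}) \<inter> K"
      using g(2)[unfolded continuous_on_open_invariant, rule_format, of "- {0}"] by auto
    have "x \<in> K"
      using \<open>x \<in> cs_support s\<close> carried_by_hull_subset[OF s] hull_subset[of "cs_support s" convex]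
      unfolding cs_hull_def by blast
    then have "emeasure (base s) U > 0"
      using U \<open>g x \<noteq> 0\<close> \<open>x \<in> cs_support s\<close> unfolding cs_support_def msupport_def by blast
    moreover have "AE y in base s. y \<notin> U"
      using ae D(6) by eventually_elim (use U in auto)
    then have "emeasure (base s) U = 0"
      using AE_iff_measurable[of U "base s" "\<lambda>y. y \<notin> U"] U(1) D(2) sets_eq_imp_space_eq[OF D(2)] by auto
    ultimately show False by simp
  qed
qed

lemma zero_on_support_of_moments:
  fixes g :: "real \<Rightarrow> complex"
  assumes s: "carried_by s K" and g: "g \<in> borel_measurable borel" "continuous_on K g"
    and m: "\<And>n. cs_integral s (\<lambda>x. of_real x ^ n * g x) = 0" and "x \<in> cs_support s"
  shows "g x = 0"
proof -
  have [measurable]: "g \<in> borel_measurable borel" by fact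
  have m': "(\<integral>x. of_real x ^ n * g x \<partial>base s) = 0" for n
    using m[of n] carried_byD(1)[OF s] by (auto simp: cs_integral_def)
  have int: "integrable (base s) (\<lambda>x. of_real x ^ n * g x)" for n
    by (intro carried_by_integrable[OF s] continuous_intros g) measurable
  have "(\<integral>x. x ^ n * Re (g x) \<partial>base s) = 0" for n
    using integral_Re[OF int[of n]] m'[of n] by (simp flip: of_real_power)
  moreover have "(\<integral>x. x ^ n * Im (g x) \<partial>base s) = 0" for n
    using integral_Im[OF int[of n]] m'[of n] by (simp flip: of_real_power)
  moreover have "continuous_on K (\<lambda>x. Re (g x))" "continuous_on K (\<lambda>x. Im (g x))"
    by (intro continuous_intros g)+
  ultimately have "Re (g x) = 0" "Im (g x) = 0"
    using zero_on_support_of_moments_real[OF s _ _ _ \<open>x \<in> cs_support s\<close>, of "\<lambda>x. Re (g x)"]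
      zero_on_support_of_moments_real[OF s _ _ _ \<open>x \<in> cs_support s\<close>, of "\<lambda>x. Im (g x)"]
    by auto
  then show ?thesis by (simp add: complex_eq_iff)
qed

text \<open>
  For \<open>a = 0\<close> this is the independence of \<open>1, s_hat \<sigma> 1, \<dots>, s_hat \<sigma> b\<close> over the polynomials;
  the induction runs through larger \<open>a\<close>. Each Cauchy transform of \<open>nik \<sigma> (a + 1) k\<close> is an
  integral against \<open>\<sigma> (a + 1)\<close> of the transform one level further down, so a vanishing combination
  says that the combination \<open>F\<close> of the next level has only zero moments against \<open>\<sigma> (a + 1)\<close>, whence
  \<open>F = 0\<close> on the support. That set is infinite and compact, and \<open>F\<close> is analytic on a connected
  neighbourhood of it that reaches infinity; so \<open>F\<close> vanishes near infinity too, and the induction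
  continues with fewer functions.
\<close>

lemma nikishin_independent:
  assumes "\<And>i. i \<in> {Suc a..b} \<Longrightarrow> \<sigma> i \<in> class_M (\<Delta> i)"
    and "\<And>i. i \<in> {Suc a..<b} \<Longrightarrow> \<Delta> i \<inter> \<Delta> (Suc i) = {}"
    and "\<forall>\<^sub>F z in at_infinity.
      poly (p a) z + (\<Sum>k\<in>{Suc a..b}. poly (p k) z * cauchy (nik \<sigma> (Suc a) k) z) = 0"
    and "k \<in> {a..b}"
  shows "p k = (0 :: complex poly)"
  using assms
proof (induction "b - a" arbitrary: a k)
  case 0
  then have "k = a" "b = a" by auto
  with 0 show ?case
    by (intro poly_tendsto_0_imp_eq_0 tendsto_eventually) auto
next
  case (Suc n)
  then have "a < b" by auto
  define s K where "s = \<sigma> (Suc a)" and "K = \<Delta> (Suc a)"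
  \<comment> \<open>for \<open>b = a + 1\<close> there is no further level, and \<open>F\<close> is a polynomial\<close>
  define L where "L = (if Suc a < b then \<Delta> (Suc (Suc a)) else {})"
  have KL: "K \<inter> L = {}" using Suc.prems(2)[of "Suc a"] by (auto simp: K_def L_def)
  have sM: "s \<in> class_M K" using Suc.prems(1) \<open>a < b\<close> by (auto simp: s_def K_def)
  note s = class_M_carried_by(1)[OF sM]
  have L: "compact L" "convex L"
    using class_M_carried_by(1)[OF Suc.prems(1)[of "Suc (Suc a)"]] \<open>a < b\<close>
    by (auto simp: L_def carried_by_def)
  have nik: "carried_by (nik \<sigma> (Suc (Suc a)) k) L" if "k \<in> {Suc (Suc a)..b}" for k
    using that Suc.prems(1,2) carried_by_nik[of "Suc (Suc a)" k \<sigma> \<Delta>] class_M_carried_by(1)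
    by (auto simp: L_def)
  define \<psi> where "\<psi> k z = (if k = Suc a then 1 else cauchy (nik \<sigma> (Suc (Suc a)) k) (z::complex))" for k z
  define F where "F z = (\<Sum>k\<in>{Suc a..b}. poly (p k) z * \<psi> k z)" for z
  have \<psi>hol: "\<psi> k holomorphic_on (- complex_of_real ` L)" if "k \<in> {Suc a..b}" for k
  proof (cases "k = Suc a")
    case True
    then show ?thesis by (simp add: \<psi>_def[abs_def])
  next
    case False
    then show ?thesis using that holomorphic_cauchy[OF nik, of k]
      by (simp add: \<psi>_def[abs_def])
  qed
  have \<psi>c: "continuous_on K (\<lambda>x. \<psi> k (of_real x))" if "k \<in> {Suc a..b}" for k
    using KL by (intro continuous_on_compose2[OF holomorphic_on_imp_continuous_on[OF \<psi>hol[OF that]]] continuous_intros) auto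
  have \<psi>m: "(\<lambda>x::real. \<psi> k (of_real x)) \<in> borel_measurable borel" if "k \<in> {Suc a..b}" for k
  proof (cases "k = Suc a")
    case False
    then have "(cauchy (nik \<sigma> (Suc (Suc a)) k) :: complex \<Rightarrow> complex) \<in> borel_measurable borel"
      using that by (intro borel_measurable_cauchy[OF nik]) auto
    then show ?thesis using False by (simp add: \<psi>_def measurable_compose[OF borel_measurable_of_real])
  qed (simp add: \<psi>_def)
  have cauchy_nik: "cauchy (nik \<sigma> (Suc a) k) z = cs_integral s (\<lambda>x. \<psi> k (of_real x) / (z - of_real x))"
    if "k \<in> {Suc a..b}" for k z
  proof (cases "k = Suc a")
    case True
    then show ?thesis by (subst nik.simps) (simp add: cauchy_def \<psi>_def s_def)
  next
    case False
    have "(\<lambda>x. 1 / (z - complex_of_real x)) \<in> borel_measurable borel" by measurable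
    then have "cauchy (cs_bracket s (nik \<sigma> (Suc (Suc a)) k)) z = 
        cs_integral s (\<lambda>x. cauchy (nik \<sigma> (Suc (Suc a)) k) x *\<^sub>R (1 / (z - of_real x)))"
      using carried_by_bracket(2)[OF s nik KL, of k "\<lambda>x. 1 / (z - complex_of_real x)"] that False
      by (simp add: cauchy_def)
    then show ?thesis
      using False that by (subst nik.simps) (simp add: \<psi>_def s_def cauchy_of_real scaleR_conv_of_real)
  qed
  have "cs_integral s (\<lambda>x. of_real x ^ \<nu> * F (of_real x)) = 0" for \<nu>
    unfolding F_def
  proof (rule moments_vanish_of_bigo[OF s _ \<psi>m \<psi>c, where N = "Suc \<nu>" and d = "- p a"])
    have "\<forall>\<^sub>F z in at_infinity. (\<Sum>k = Suc a..b. poly (p k) z *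
           cs_integral s (\<lambda>x. \<psi> k (of_real x) / (z - of_real x))) - poly (- p a) z = 0"
      using Suc.prems(3) by eventually_elim (simp add: cauchy_nik add.commute)
    then show "(\<lambda>z. (\<Sum>k = Suc a..b. poly (p k) z *
           cs_integral s (\<lambda>x. \<psi> k (of_real x) / (z - of_real x))) - poly (- p a) z)
       \<in> O[at_infinity](\<lambda>z. 1 / z ^ (Suc \<nu> + 1))"
      by (intro bigoI[where c = 0]) (auto elim: eventually_mono)
  qed auto
  then have F0: "F (of_real x) = 0" if "x \<in> cs_support s" for x
    using that
    by (intro zero_on_support_of_moments[OF s, of "\<lambda>x. F (of_real x)"])
      (auto simp: F_def intro!: borel_measurable_sum borel_measurable_times borel_measurable_poly_of_real \<psi>m
         continuous_intros \<psi>c)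
  have supp: "compact (cs_support s)" "infinite (cs_support s)" "cs_support s \<subseteq> K"
    using sM class_M_carried_by(2)[OF sM] hull_subset[of "cs_support s" convex]
    by (auto simp: class_M_def cs_hull_def)
  let ?U = "complex_of_real ` cs_support s"
  have "compact ?U" "infinite ?U"
    using supp by (auto intro!: compact_continuous_image continuous_intros dest!: finite_imageD simp: inj_on_def)
  then obtain \<xi> where \<xi>: "\<xi> \<in> ?U" "\<xi> islimpt ?U"
    using compact_eq_Bolzano_Weierstrass[of ?U] by blast
  have US: "?U \<subseteq> - complex_of_real ` L" using supp KL by auto
  have Fhol: "F holomorphic_on (- complex_of_real ` L)"
    unfolding F_def by (intro holomorphic_intros \<psi>hol) 
  have cL: "compact (complex_of_real ` L)" "convex (complex_of_real ` L)"
    using L by (auto intro!: compact_continuous_image continuous_intros convex_linear_image simp: linear_of_real)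
  have "F z = 0" if "z \<notin> complex_of_real ` L" for z
    using analytic_continuation[OF Fhol _ _ US _ \<xi>(2), of z] F0 \<xi>(1) US that cL
      connected_complement_bounded_convex[OF compact_imp_bounded cL(2)]
    by (auto simp: open_Compl compact_imp_closed)
  then have "\<forall>\<^sub>F z in at_infinity. F z = 0"
    using eventually_off_compact_at_infinity[OF L(1)] by (auto elim: eventually_mono)
  moreover have "F z = poly (p (Suc a)) z +
     (\<Sum>k\<in>{Suc (Suc a)..b}. poly (p k) z * cauchy (nik \<sigma> (Suc (Suc a)) k) z)" for z
    using \<open>a < b\<close> by (simp add: F_def \<psi>_def sum.atLeast_Suc_atMost[of "Suc a" b])
  ultimately have tail: "p k = 0" if "k \<in> {Suc a..b}" for k
    using Suc.hyps(2) Suc.prems(1,2) that by (intro Suc.hyps(1)[of "Suc a"]) auto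
  have "\<forall>\<^sub>F z in at_infinity. poly (p a) z = 0"
    using Suc.prems(3) by eventually_elim (simp add: tail)
  then have "p a = 0"
    by (intro poly_tendsto_0_imp_eq_0 tendsto_eventually)
  then show ?case
    using tail[of k] Suc.prems(4) by (cases "k = a") auto
qed

section \<open>Association as an equality of function spaces\<close>

lemma sum_fun_apply: "(\<Sum>i\<in>A. h i) x = (\<Sum>i\<in>A. h i x)"
  by (induction A rule: infinite_finite_induct) auto

text \<open>
  Steinitz exchange for families of functions restricted to a set \<open>D\<close>: a \<open>g j\<close> outside
  the span of the functions \<open>f i\<close> could be added to them, giving an independent set that has more
  elements than the family \<open>g\<close> whose span contains it.
\<close>

lemma exchange_spanning_family:
  fixes f :: "'i \<Rightarrow> 'x \<Rightarrow> 'v::real_vector" and g :: "'j \<Rightarrow> 'x \<Rightarrow> 'v"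
  assumes "finite I" "finite J" and card: "card J \<le> card I"
    and span: "\<And>i. i \<in> I \<Longrightarrow> \<exists>c. \<forall>x\<in>D. f i x = (\<Sum>j\<in>J. c j *\<^sub>R g j x)"
    and indep: "\<And>c i. (\<forall>x\<in>D. (\<Sum>i\<in>I. c i *\<^sub>R f i x) = 0) \<Longrightarrow> i \<in> I \<Longrightarrow> c i = 0"
    and "j \<in> J"
  shows "\<exists>c. \<forall>x\<in>D. g j x = (\<Sum>i\<in>I. c i *\<^sub>R f i x)"
proof -
  interpret fs: vector_space "\<lambda>(r::real) (h::'x \<Rightarrow> 'v) x. r *\<^sub>R h x"
    by unfold_locales (auto simp: fun_eq_iff algebra_simps)
  define F where "F i x = (if x \<in> D then f i x else 0)" for i x
  define G where "G j x = (if x \<in> D then g j x else 0)" for j x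
  \<comment> \<open>independence of a family includes that its members are distinct\<close>
  have inj: "inj_on F I"
  proof (rule inj_onI, rule ccontr)
    fix i i' assume i: "i \<in> I" "i' \<in> I" "F i = F i'" "i \<noteq> i'"
    have "(\<Sum>k\<in>I. ((if k = i then 1 else 0) - (if k = i' then 1 else 0)) *\<^sub>R f k x) = 0" if "x \<in> D" for x
    proof -
      have "(\<Sum>k\<in>I. ((if k = i then 1 else 0) - (if k = i' then 1 else 0)) *\<^sub>R f k x) =
          (\<Sum>k\<in>I. (if k = i then f k x else 0) - (if k = i' then f k x else 0))"
        by (intro sum.cong) (auto simp: scaleR_left_diff_distrib)
      also have "\<dots> = f i x - f i' x"
        using i \<open>finite I\<close> by (simp add: sum_subtractf)
      also have "\<dots> = 0" using fun_cong[OF i(3), of x] that by (simp add: F_def)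
      finally show ?thesis .
    qed
    with indep[of "\<lambda>k. (if k = i then 1 else 0) - (if k = i' then 1 else 0)" i] i
    show False by auto
  qed
  have ind: "fs.independent (F ` I)"
  proof (rule fs.independent_if_scalars_zero)
    fix u v assume u: "(\<Sum>v\<in>F ` I. (\<lambda>x. u v *\<^sub>R v x)) = 0" and v: "v \<in> F ` I"
    have "(\<Sum>i\<in>I. u (F i) *\<^sub>R f i x) = 0" if "x \<in> D" for x
      using fun_cong[OF u, of x] that by (simp add: sum_fun_apply sum.reindex[OF inj] F_def)
    with indep[of "\<lambda>i. u (F i)"] v show "u v = 0" by auto
  qed (use \<open>finite I\<close> in auto)
  have sub: "F ` I \<subseteq> fs.span (G ` J)"
  proof safe
    fix i assume "i \<in> I"
    with span obtain c where "\<forall>x\<in>D. f i x = (\<Sum>j\<in>J. c j *\<^sub>R g j x)" by metis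
    then have "F i = (\<Sum>j\<in>J. (\<lambda>x. c j *\<^sub>R G j x))"
      by (auto simp: fun_eq_iff sum_fun_apply F_def G_def)
    also have "\<dots> \<in> fs.span (G ` J)"
      by (intro fs.span_sum fs.span_scale fs.span_base) auto
    finally show "F i \<in> fs.span (G ` J)" .
  qed
  have "G j \<in> fs.span (F ` I)"
  proof (rule ccontr)
    assume *: "G j \<notin> fs.span (F ` I)"
    then have "G j \<notin> F ` I" using fs.span_base by blast
    have "fs.independent (insert (G j) (F ` I))"
      using * ind by (simp add: fs.independent_insert)
    moreover have "insert (G j) (F ` I) \<subseteq> fs.span (G ` J)"
      using sub \<open>j \<in> J\<close> by (auto intro: fs.span_base)
    ultimately have "card (insert (G j) (F ` I)) \<le> card (G ` J)"
      using fs.independent_span_bound \<open>finite J\<close> by blast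
    also have "\<dots> \<le> card J" using \<open>finite J\<close> by (rule card_image_le)
    finally show False
      using \<open>finite I\<close> \<open>G j \<notin> F ` I\<close> card by (simp add: card_image[OF inj])
  qed
  then obtain u where "G j = (\<Sum>v\<in>F ` I. (\<lambda>x. u v *\<^sub>R v x))"
    using \<open>finite I\<close> by (auto simp: fs.span_finite)
  then have "G j x = (\<Sum>i\<in>I. u (F i) *\<^sub>R F i x)" for x
    by (simp add: sum_fun_apply sum.reindex[OF inj])
  then have "g j x = (\<Sum>i\<in>I. u (F i) *\<^sub>R f i x)" if "x \<in> D" for x
    using that by (metis (mono_tags, lifting) F_def G_def sum.cong)
  then show ?thesis by (intro exI[of _ "\<lambda>i. u (F i)"]) auto
qed

lemma linear_form_altdef: "linear_form m \<sigma> p z = (\<Sum>k\<in>{0..m}. poly (p k) z * s_hat \<sigma> k z)"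
proof -
  have "{0..m} = insert 0 {1..m}" by auto
  then show ?thesis by (simp add: linear_form_def s_hat_def)
qed

lemma s_hat_of_real: "s_hat \<sigma> k (complex_of_real x) = of_real (s_hat \<sigma> k x)"
  by (simp add: s_hat_def cauchy_of_real)

lemma poly_eq_sum_deg_lt:
  assumes "deg_lt p n"
  shows "poly (map_poly of_real p) z = (\<Sum>i<n. coeff p i *\<^sub>R (z::complex) ^ i)"
proof (cases "p = 0")
  case False
  then have "degree p < n" using assms by (simp add: deg_lt_def)
  have "poly (map_poly of_real p) z = (\<Sum>i\<le>degree p. coeff p i *\<^sub>R z ^ i)"
    by (simp add: poly_altdef degree_map_poly coeff_map_poly scaleR_conv_of_real)
  also have "\<dots> = (\<Sum>i<n. coeff p i *\<^sub>R z ^ i)"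
    using \<open>degree p < n\<close> by (intro sum.mono_neutral_left) (auto simp: coeff_eq_0 not_le)
  finally show ?thesis .
qed simp

text \<open>
  The three properties that make \<open>s_hat \<sigma> k\<close> an admissible weight in \<open>carried_by_density\<close>, and a bound
  for the support of its measure.
\<close>

lemma s_hat_regular:
  assumes carried: "\<forall>i\<in>{1..m}. carried_by (\<sigma> i) (\<Delta> i)"
    and disj: "\<forall>i\<in>{1..<m}. \<Delta> i \<inter> \<Delta> (Suc i) = {}"
    and A: "1 \<le> m \<longrightarrow> A \<inter> \<Delta> 1 = {}" "convex A" and k: "k \<le> m"
  shows "continuous_on A (s_hat \<sigma> k :: real \<Rightarrow> real)"
    and "(s_hat \<sigma> k :: real \<Rightarrow> real) \<in> borel_measurable borel"
    and "(\<forall>x\<in>A. 0 \<le> s_hat \<sigma> k (x::real)) \<or> (\<forall>x\<in>A. s_hat \<sigma> k x \<le> 0)"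
    and "1 \<le> k \<Longrightarrow> carried_by (nik \<sigma> 1 k) (\<Delta> 1)"
proof -
  have nik: "carried_by (nik \<sigma> 1 k) (\<Delta> 1)" if "1 \<le> k"
    using carried disj k that by (intro carried_by_nik) auto
  then show "1 \<le> k \<Longrightarrow> carried_by (nik \<sigma> 1 k) (\<Delta> 1)" .
  have "continuous_on A (s_hat \<sigma> k :: real \<Rightarrow> real) \<and>
     (s_hat \<sigma> k :: real \<Rightarrow> real) \<in> borel_measurable borel \<and>
     ((\<forall>x\<in>A. 0 \<le> s_hat \<sigma> k (x::real)) \<or> (\<forall>x\<in>A. s_hat \<sigma> k x \<le> 0))"
  proof (cases "k = 0")
    case True
    then show ?thesis by (simp add: s_hat_def[abs_def])
  next
    case False
    then have *: "(s_hat \<sigma> k :: real \<Rightarrow> real) = cauchy (nik \<sigma> 1 k)" "1 \<le> k" "A \<inter> \<Delta> 1 = {}"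
      using A(1) k by (auto simp: s_hat_def fun_eq_iff)
    show ?thesis
      unfolding *(1)
      by (intro conjI continuous_on_cauchy[OF nik] borel_measurable_cauchy[OF nik]
          cauchy_constant_sign[OF nik] A(2) *)
  qed
  then show "continuous_on A (s_hat \<sigma> k :: real \<Rightarrow> real)"
    "(s_hat \<sigma> k :: real \<Rightarrow> real) \<in> borel_measurable borel"
    "(\<forall>x\<in>A. 0 \<le> s_hat \<sigma> k (x::real)) \<or> (\<forall>x\<in>A. s_hat \<sigma> k x \<le> 0)" by auto
qed

text \<open>
  Association expresses forms in the \<open>\<sigma>\<close>-system through forms in the \<open>\<rho>\<close>-system; orthogonality needs
  the converse. Both spaces of forms have \<open>\<Sum>j. n j\<close> generators, because \<open>lam\<close> permutes the indices.
  Those on the \<open>\<sigma>\<close> side are independent by \<open>nikishin_independent\<close>, so by exchange the two spaces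
  coincide, and every generator on the \<open>\<rho>\<close> side is a real combination of those on the \<open>\<sigma>\<close> side.
\<close>

lemma associated_expansion:
  assumes cls: "\<And>i. i \<in> {1..m} \<Longrightarrow> \<sigma> i \<in> class_M (\<Delta> i)"
    and disj: "\<And>i. i \<in> {1..<m} \<Longrightarrow> \<Delta> i \<inter> \<Delta> (Suc i) = {}"
    and assoc: "associated m lam \<rho> \<sigma> n" and bounded: "\<And>k. k \<in> {1..m} \<Longrightarrow> bounded (cs_hull (nik \<sigma> 1 k) \<union> cs_hull (nik \<rho> 1 k))"
    and k: "k \<le> m" "\<nu> < n (lam k)"
  shows "\<exists>c::nat \<times> nat \<Rightarrow> real. \<forall>z.
     z \<notin> complex_of_real ` (\<Union>k\<in>{1..m}. cs_hull (nik \<sigma> 1 k) \<union> cs_hull (nik \<rho> 1 k)) \<longrightarrow>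
     z ^ \<nu> * s_hat \<rho> k z * s_hat \<sigma> (lam 0) z =
     (\<Sum>(j,i)\<in>(SIGMA j:{0..m}. {..<n j}). c (j, i) *\<^sub>R (z ^ i * s_hat \<sigma> j z))"
proof -
  define X where "X = (\<Union>k\<in>{1..m}. cs_hull (nik \<sigma> 1 k) \<union> cs_hull (nik \<rho> 1 k))"
  have "bounded X" unfolding X_def using bounded by blast
  then have ev: "\<forall>\<^sub>F z in at_infinity. z \<notin> complex_of_real ` X"
    using eventually_off_compact_at_infinity[of "closure X"] closure_subset[of X]
    by (auto elim!: eventually_mono simp: compact_closure)
  define I where "I = (SIGMA j:{0..m}. {..<n j})"
  define J where "J = (SIGMA k:{0..m}. {..<n (lam k)})"
  define f where "f = (\<lambda>(j, i) z. z ^ i * s_hat \<sigma> j (z::complex))"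
  define g where "g = (\<lambda>(k, i) z. z ^ i * s_hat \<rho> k (z::complex) * s_hat \<sigma> (lam 0) z)"
  have lam: "lam permutes {0..m}" using assoc by (simp add: associated_def)
  have card: "card J = card I"
    using sum.permute[OF lam, of n] by (simp add: I_def J_def card_SigmaI)
  have "\<exists>c. \<forall>z\<in>- complex_of_real ` X. g (k, \<nu>) z = (\<Sum>i\<in>I. c i *\<^sub>R f i z)"
  proof (rule exchange_spanning_family[where J = J])
    show "finite I" "finite J" by (auto simp: I_def J_def)
    show "card J \<le> card I" using card by simp
    show "(k, \<nu>) \<in> J" using k by (simp add: J_def)
  next
    fix ji assume "ji \<in> I"
    then obtain j i where ji: "ji = (j, i)" "j \<le> m" "i < n j" by (auto simp: I_def)
    \<comment> \<open>the form \<open>z\<^sup>i s_hat \<sigma> j\<close> is an admissible left-hand side of the association\<close>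
    define p :: "nat \<Rightarrow> real poly" where "p k = (if k = j then monom 1 i else 0)" for k
    have "\<forall>k\<le>m. deg_lt (p k) (n k)"
      using ji by (auto simp: p_def deg_lt_def degree_monom_eq)
    then obtain q :: "nat \<Rightarrow> real poly" where q: "\<forall>k\<le>m. deg_lt (q k) (n (lam k))"
      "\<forall>z. z \<notin> complex_of_real ` X \<longrightarrow>
              linear_form m \<sigma> (\<lambda>k. map_poly of_real (p k)) z =
              linear_form m \<rho> (\<lambda>k. map_poly of_real (q k)) z * s_hat \<sigma> (lam 0) z"
      using assoc unfolding associated_def X_def by blast
    have "f ji z = (\<Sum>j\<in>J. (case j of (k, i) \<Rightarrow> coeff (q k) i) *\<^sub>R g j z)" if "z \<in> - complex_of_real ` X" for z
    proof -
      have "f ji z = (\<Sum>k\<in>{0..m}. if k = j then z ^ i * s_hat \<sigma> k z else 0)"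
        using ji by (simp add: f_def)
      also have "\<dots> = linear_form m \<sigma> (\<lambda>k. map_poly of_real (p k)) z"
        unfolding linear_form_altdef
        by (intro sum.cong) (auto simp: p_def map_poly_monom poly_monom)
      also have "\<dots> = linear_form m \<rho> (\<lambda>k. map_poly of_real (q k)) z * s_hat \<sigma> (lam 0) z"
        using q(2) that by auto
      also have "\<dots> = (\<Sum>k\<in>{0..m}. \<Sum>i<n (lam k). coeff (q k) i *\<^sub>R g (k, i) z)"
        unfolding linear_form_altdef sum_distrib_right
      proof (intro sum.cong refl)
        fix k assume "k \<in> {0..m}"
        then have "poly (map_poly of_real (q k)) z = (\<Sum>i<n (lam k). coeff (q k) i *\<^sub>R z ^ i)"
          using q(1) by (intro poly_eq_sum_deg_lt) auto
        then show "poly (map_poly of_real (q k)) z * s_hat \<rho> k z * s_hat \<sigma> (lam 0) z =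
            (\<Sum>i<n (lam k). coeff (q k) i *\<^sub>R g (k, i) z)"
          by (simp add: sum_distrib_right g_def)
      qed
      also have "\<dots> = (\<Sum>j\<in>J. (case j of (k, i) \<Rightarrow> coeff (q k) i) *\<^sub>R g j z)"
        unfolding J_def by (subst sum.Sigma) (auto intro!: sum.cong)
      finally show ?thesis .
    qed
    then show "\<exists>c. \<forall>z\<in>- complex_of_real ` X. f ji z = (\<Sum>j\<in>J. c j *\<^sub>R g j z)"
      by (intro exI[of _ "\<lambda>(k, i). coeff (q k) i"]) auto
  next
    fix c ji assume c: "\<forall>z\<in>- complex_of_real ` X. (\<Sum>i\<in>I. c i *\<^sub>R f i z) = 0" and "ji \<in> I"
    then obtain j i where ji: "ji = (j, i)" "j \<le> m" "i < n j" by (auto simp: I_def)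
    define p :: "nat \<Rightarrow> complex poly" where "p j = (\<Sum>i<n j. monom (of_real (c (j, i))) i)" for j
    have form: "linear_form m \<sigma> p z = (\<Sum>i\<in>I. c i *\<^sub>R f i z)" for z
    proof -
      have "linear_form m \<sigma> p z = (\<Sum>j\<in>{0..m}. \<Sum>i<n j. c (j, i) *\<^sub>R f (j, i) z)"
        unfolding linear_form_altdef
        by (intro sum.cong) (auto simp: p_def f_def poly_sum poly_monom sum_distrib_left scaleR_conv_of_real mult_ac)
      then show ?thesis
        unfolding I_def by (subst (asm) sum.Sigma) (auto intro!: sum.cong)
    qed
    have "p j = 0"
    proof (rule nikishin_independent[where a = 0 and b = m and \<sigma> = \<sigma> and \<Delta> = \<Delta>])
      show "\<forall>\<^sub>F z in at_infinity. poly (p 0) z + (\<Sum>k\<in>{Suc 0..m}. poly (p k) z * cauchy (nik \<sigma> (Suc 0) k) z) = 0"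
        using ev
      proof eventually_elim
        case (elim z)
        then have "linear_form m \<sigma> p z = 0" using c form by auto
        then show ?case by (simp add: linear_form_def s_hat_def)
      qed
    qed (use cls disj ji in auto)
    then have "coeff (p j) i = 0" by simp
    moreover have "coeff (p j) i = of_real (c (j, i))"
      using ji by (simp add: p_def coeff_sum)
    ultimately show "c ji = 0" using ji by simp
  qed
  then obtain c where c: "\<forall>z\<in>- complex_of_real ` X. g (k, \<nu>) z = (\<Sum>i\<in>I. c i *\<^sub>R f i z)" ..
  show ?thesis
    unfolding X_def[symmetric] I_def[symmetric]
    using c by (intro exI[of _ c]) (auto simp: g_def f_def case_prod_beta)
qed

section \<open>Orthogonality of the mixed type linear form\<close>

theorem theorem1p4:
  fixes m1 m2 :: nat
    and \<sigma>1 \<sigma>2 \<rho> :: "nat \<Rightarrow> cs_measure"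
    and n1 n2 :: "nat \<Rightarrow> nat"
    and lam :: "nat \<Rightarrow> nat"
    and a :: "nat \<Rightarrow> complex poly"
  assumes "generates_nikishin \<sigma>1 0 m1"
    and "generates_nikishin \<sigma>2 0 m2"
    and "\<sigma>1 0 = \<sigma>2 0"
    and "(\<Sum>j=0..m1. n1 j) = (\<Sum>j=0..m2. n2 j) + 1"
    and "mixed_type_vector m1 m2 \<sigma>1 \<sigma>2 n1 n2 a"
    and "associated m2 lam \<rho> \<sigma>2 n2"
    and "m2 \<ge> 1 \<Longrightarrow> cs_hull (\<rho> 1) \<inter> cs_hull (\<sigma>2 0) = {}"
    and "\<rho> 0 = cs_density (\<sigma>2 0) (s_hat \<sigma>2 (lam 0))"
  shows "\<forall>k\<le>m2. \<forall>\<nu><n2 (lam k).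
    integrable (base (nik \<rho> 0 k)) (\<lambda>x. of_real x ^ \<nu> * linear_form m1 \<sigma>1 a (of_real x)) \<and>
    cs_integral (nik \<rho> 0 k) (\<lambda>x. of_real x ^ \<nu> * linear_form m1 \<sigma>1 a (of_real x)) = 0"
proof (intro allI impI)
  fix k \<nu> assume k: "k \<le> m2" "\<nu> < n2 (lam k)"
  obtain \<Delta>1 where \<Delta>1: "\<forall>j\<in>{0..m1}. \<sigma>1 j \<in> class_M (\<Delta>1 j)" "\<forall>j\<in>{0..<m1}. \<Delta>1 j \<inter> \<Delta>1 (Suc j) = {}"
    using assms(1) unfolding generates_nikishin_def by auto
  obtain \<Delta>2 where \<Delta>2: "\<forall>j\<in>{0..m2}. \<sigma>2 j \<in> class_M (\<Delta>2 j)" "\<forall>j\<in>{0..<m2}. \<Delta>2 j \<inter> \<Delta>2 (Suc j) = {}"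
    using assms(2) unfolding generates_nikishin_def by auto
  obtain \<Delta>\<rho> where \<Delta>\<rho>: "\<forall>j\<in>{1..m2}. \<rho> j \<in> class_M (\<Delta>\<rho> j)" "\<forall>j\<in>{1..<m2}. \<Delta>\<rho> j \<inter> \<Delta>\<rho> (Suc j) = {}"
    using assms(6) unfolding generates_nikishin_def associated_def by auto
  have lam0: "lam 0 \<le> m2"
    using permutes_in_image[of lam "{0..m2}" 0] assms(6) by (auto simp: associated_def)
  define K where "K = cs_hull (\<sigma>2 0)"
  have gen0: "\<sigma>2 0 \<in> class_M (\<Delta>1 0)" "\<sigma>2 0 \<in> class_M (\<Delta>2 0)"
    using \<Delta>1(1) \<Delta>2(1) assms(3) by force+
  have K: "\<Delta>1 0 = K" "\<Delta>2 0 = K"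
    unfolding K_def by (rule class_M_carried_by(2)[OF gen0(1)], rule class_M_carried_by(2)[OF gen0(2)])
  have s: "carried_by (\<sigma>2 0) K" using \<Delta>2(1) K class_M_carried_by(1) by force
  have "convex K" using s by (rule carried_byD)
  have "m2 \<ge> 1 \<Longrightarrow> \<Delta>\<rho> 1 = cs_hull (\<rho> 1)"
    using \<Delta>\<rho>(1) class_M_carried_by(2) by force
  then have K\<rho>: "1 \<le> m2 \<longrightarrow> K \<inter> \<Delta>\<rho> 1 = {}" using assms(7) by (auto simp: K_def)
  have K1: "1 \<le> m1 \<longrightarrow> K \<inter> \<Delta>1 1 = {}" using \<Delta>1(2) K by force
  have K2: "1 \<le> m2 \<longrightarrow> K \<inter> \<Delta>2 1 = {}" using \<Delta>2(2) K by force
  have gen: "\<forall>j\<in>{1..m1}. carried_by (\<sigma>1 j) (\<Delta>1 j)" "\<forall>j\<in>{1..<m1}. \<Delta>1 j \<inter> \<Delta>1 (Suc j) = {}"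
    "\<forall>j\<in>{1..m2}. carried_by (\<sigma>2 j) (\<Delta>2 j)" "\<forall>j\<in>{1..<m2}. \<Delta>2 j \<inter> \<Delta>2 (Suc j) = {}"
    "\<forall>j\<in>{1..m2}. carried_by (\<rho> j) (\<Delta>\<rho> j)"
    using \<Delta>1 \<Delta>2 \<Delta>\<rho>(1) class_M_carried_by(1) by auto
  note hat1 = s_hat_regular[OF gen(1,2) K1 \<open>convex K\<close>]
  note hat2 = s_hat_regular[OF gen(3,4) K2 \<open>convex K\<close>]
  note hat\<rho> = s_hat_regular[OF gen(5) \<Delta>\<rho>(2) K\<rho> \<open>convex K\<close>]
  define A where "A x = linear_form m1 \<sigma>1 a (of_real x)" for x
  have A: "A x = (\<Sum>l\<in>{0..m1}. poly (a l) (of_real x) * of_real (s_hat \<sigma>1 l x))" for x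
    by (simp add: A_def linear_form_altdef s_hat_of_real)
  have Ac: "continuous_on K A" unfolding A by (intro continuous_intros hat1(1)) auto
  have Am [measurable]: "A \<in> borel_measurable borel" unfolding A
    by (intro borel_measurable_sum borel_measurable_times borel_measurable_poly_of_real
        measurable_compose[OF hat1(2) borel_measurable_of_real]) auto
  have moments: "cs_integral (\<sigma>2 0) (\<lambda>x. of_real x ^ i * (of_real (s_hat \<sigma>2 j x) * A x)) = 0"
    if "j \<le> m2" "i < n2 j" for i j
  proof -
    obtain d where d: "(\<lambda>z. (\<Sum>l=0..m1. S_entry \<sigma>1 \<sigma>2 j l z * poly (a l) z) - poly d z)
          \<in> O[at_infinity](\<lambda>z. 1 / z ^ (n2 j + 1))"
      using assms(5) \<open>j \<le> m2\<close> unfolding mixed_type_vector_def by blast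
    have "cs_integral (\<sigma>2 0) (\<lambda>x. of_real x ^ i *
        (\<Sum>l\<in>{0..m1}. poly (a l) (of_real x) * complex_of_real (W_entry \<sigma>1 \<sigma>2 j l x))) = 0"
    proof (rule moments_vanish_of_bigo[OF s _ _ _ _ \<open>i < n2 j\<close>])
      fix l assume "l \<in> {0..m1}"
      then show "(\<lambda>x. complex_of_real (W_entry \<sigma>1 \<sigma>2 j l x)) \<in> borel_measurable borel"
        "continuous_on K (\<lambda>x. complex_of_real (W_entry \<sigma>1 \<sigma>2 j l x))"
        unfolding W_entry_def using \<open>j \<le> m2\<close>
        by (auto intro!: measurable_compose[OF _ borel_measurable_of_real] borel_measurable_times hat1(2) hat2(2)
            continuous_intros hat1(1) hat2(1))
    qed (use d in \<open>simp_all add: S_entry_def mult.commute\<close>)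
    then show ?thesis
      by (simp add: A W_entry_def sum_distrib_left mult_ac)
  qed
  define X where "X = (\<Union>k\<in>{1..m2}. cs_hull (nik \<sigma>2 1 k) \<union> cs_hull (nik \<rho> 1 k))"
  have hulls: "cs_hull (nik \<sigma>2 1 l) \<subseteq> \<Delta>2 1" "cs_hull (nik \<rho> 1 l) \<subseteq> \<Delta>\<rho> 1" if "l \<in> {1..m2}" for l
    using that hat2(4)[of l] hat\<rho>(4)[of l] carried_by_hull_subset by auto
  \<comment> \<open>so the expansion, which holds off \<open>X\<close>, may be evaluated on \<open>K\<close>\<close>
  have KX: "K \<inter> X = {}"
    using hulls K2 K\<rho> unfolding X_def by fastforce
  have bdd: "bounded (cs_hull (nik \<sigma>2 1 l) \<union> cs_hull (nik \<rho> 1 l))" if "l \<in> {1..m2}" for l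
    using hulls[OF that] that carried_byD(4)[OF hat2(4)[of l]] carried_byD(4)[OF hat\<rho>(4)[of l]]
    by (auto intro: bounded_subset compact_imp_bounded)
  obtain c :: "nat \<times> nat \<Rightarrow> real" where c: "\<And>z. z \<notin> complex_of_real ` X \<Longrightarrow>
     z ^ \<nu> * s_hat \<rho> k z * s_hat \<sigma>2 (lam 0) z =
     (\<Sum>(j,i)\<in>(SIGMA j:{0..m2}. {..<n2 j}). c (j, i) *\<^sub>R (z ^ i * s_hat \<sigma>2 j z))"
    using associated_expansion[OF _ _ assms(6) bdd k, of \<Delta>2] \<Delta>2 unfolding X_def by auto
  have \<rho>0: "carried_by (\<rho> 0) K"
    "\<And>f. f \<in> borel_measurable borel \<Longrightarrow>
      cs_integral (\<rho> 0) f = cs_integral (\<sigma>2 0) (\<lambda>x. s_hat \<sigma>2 (lam 0) x *\<^sub>R (f x :: complex))"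
    unfolding assms(8)
    using carried_by_density[OF s hat2(2)[OF lam0] hat2(1)[OF lam0] hat2(3)[OF lam0]] by auto
  define h where "h x = of_real x ^ \<nu> * A x" for x
  have hm [measurable]: "h \<in> borel_measurable borel" unfolding h_def by measurable
  have hc: "continuous_on K h" unfolding h_def by (intro continuous_intros Ac)
  \<comment> \<open>all measures of the new system have densities against the common \<open>\<sigma>2 0\<close>\<close>
  have nik0: "carried_by (nik \<rho> 0 k) K \<and>
    cs_integral (nik \<rho> 0 k) h = cs_integral (\<sigma>2 0) (\<lambda>x. (s_hat \<sigma>2 (lam 0) x * s_hat \<rho> k x) *\<^sub>R h x)"
  proof (cases "k = 0")
    case True
    then show ?thesis using \<rho>0 hm by (subst (1 2) nik.simps) (simp add: s_hat_def)
  next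
    case False
    have L: "carried_by (nik \<rho> (Suc 0) k) (\<Delta>\<rho> 1)" "K \<inter> \<Delta>\<rho> 1 = {}"
      using hat\<rho>(4)[of k] False k K\<rho> by auto
    have m: "(\<lambda>x. cauchy (nik \<rho> (Suc 0) k) x *\<^sub>R h x) \<in> borel_measurable borel"
      by (intro borel_measurable_scaleR borel_measurable_cauchy[OF L(1)] hm)
    have "cs_integral (cs_bracket (\<rho> 0) (nik \<rho> (Suc 0) k)) h =
        cs_integral (\<rho> 0) (\<lambda>x. cauchy (nik \<rho> (Suc 0) k) x *\<^sub>R h x)"
      by (rule carried_by_bracket(2)[OF \<rho>0(1) L hm])
    also have "\<dots> = cs_integral (\<sigma>2 0) (\<lambda>x. (s_hat \<sigma>2 (lam 0) x * s_hat \<rho> k x) *\<^sub>R h x)"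
      using False by (simp add: \<rho>0(2)[OF m] s_hat_def[of \<rho>])
    finally show ?thesis
      using carried_by_bracket(1)[OF \<rho>0(1) L] False by (subst (1 2) nik.simps) simp
  qed
  have terms: "integrable (base (\<sigma>2 0)) (\<lambda>x. c (j, i) *\<^sub>R (of_real x ^ i * (of_real (s_hat \<sigma>2 j x) * A x)))"
    "(\<lambda>x. c (j, i) *\<^sub>R (of_real x ^ i * (of_real (s_hat \<sigma>2 j x) * A x))) \<in> borel_measurable (base (\<sigma>2 0))"
    if "j \<le> m2" for i j
  proof -
    note [measurable] = hat2(2)[OF that]
    show "integrable (base (\<sigma>2 0)) (\<lambda>x. c (j, i) *\<^sub>R (of_real x ^ i * (of_real (s_hat \<sigma>2 j x) * A x)))"
      by (intro carried_by_integrable[OF s] continuous_intros Ac hat2(1) that) measurable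
    then show "(\<lambda>x. c (j, i) *\<^sub>R (of_real x ^ i * (of_real (s_hat \<sigma>2 j x) * A x))) \<in> borel_measurable (base (\<sigma>2 0))"
      by (rule borel_measurable_integrable)
  qed
  \<comment> \<open>the expansion resolves the density into the weights of \<open>moments\<close>\<close>
  have "(\<integral>x. (s_hat \<sigma>2 (lam 0) x * s_hat \<rho> k x) *\<^sub>R h x \<partial>base (\<sigma>2 0)) =
    (\<integral>x. (\<Sum>(j,i)\<in>(SIGMA j:{0..m2}. {..<n2 j}).
        c (j, i) *\<^sub>R (of_real x ^ i * (of_real (s_hat \<sigma>2 j x) * A x))) \<partial>base (\<sigma>2 0))"
  proof (rule integral_cong_AE)
    note [measurable] = hat\<rho>(2)[OF k(1)] hat2(2)[OF lam0]
    have [measurable_cong]: "sets (base (\<sigma>2 0)) = sets borel" using s by (rule carried_byD)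
    show "(\<lambda>x. (s_hat \<sigma>2 (lam 0) x * s_hat \<rho> k x) *\<^sub>R h x) \<in> borel_measurable (base (\<sigma>2 0))"
      by measurable
    show "(\<lambda>x. \<Sum>(j,i)\<in>(SIGMA j:{0..m2}. {..<n2 j}).
        c (j, i) *\<^sub>R (of_real x ^ i * (of_real (s_hat \<sigma>2 j x) * A x))) \<in> borel_measurable (base (\<sigma>2 0))"
      using terms(2) by (intro borel_measurable_sum) auto
    show "AE x in base (\<sigma>2 0). (s_hat \<sigma>2 (lam 0) x * s_hat \<rho> k x) *\<^sub>R h x =
      (\<Sum>(j,i)\<in>(SIGMA j:{0..m2}. {..<n2 j}). c (j, i) *\<^sub>R (of_real x ^ i * (of_real (s_hat \<sigma>2 j x) * A x)))"
      using carried_byD(6)[OF s]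
    proof eventually_elim
      case (elim x)
      then have "complex_of_real x \<notin> of_real ` X" using KX by auto
      from c[OF this] have "(s_hat \<sigma>2 (lam 0) x * s_hat \<rho> k x) *\<^sub>R h x =
        (\<Sum>(j,i)\<in>(SIGMA j:{0..m2}. {..<n2 j}). c (j, i) *\<^sub>R (of_real x ^ i * of_real (s_hat \<sigma>2 j x))) * A x"
        by (simp add: s_hat_of_real h_def scaleR_conv_of_real mult_ac)
      then show ?case
        by (simp add: sum_distrib_right case_prod_beta mult.assoc)
    qed
  qed
  also have "\<dots> = (\<Sum>(j,i)\<in>(SIGMA j:{0..m2}. {..<n2 j}).
        c (j, i) *\<^sub>R (\<integral>x. of_real x ^ i * (of_real (s_hat \<sigma>2 j x) * A x) \<partial>base (\<sigma>2 0)))"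
    using terms(1) by (subst Bochner_Integration.integral_sum) (auto simp: case_prod_beta)
  also have "\<dots> = 0"
  proof (rule sum.neutral, clarify)
    fix j i assume "j \<in> {0..m2}" "i < n2 j"
    then show "c (j, i) *\<^sub>R (\<integral>x. of_real x ^ i * (of_real (s_hat \<sigma>2 j x) * A x) \<partial>base (\<sigma>2 0)) = 0"
      using moments[of j i] carried_byD(1)[OF s] by (auto simp: cs_integral_def)
  qed
  finally have "cs_integral (nik \<rho> 0 k) h = 0"
    using nik0 by (simp add: cs_integral_def)
  moreover have "integrable (base (nik \<rho> 0 k)) h"
    by (rule carried_by_integrable[OF conjunct1[OF nik0] hm hc])
  ultimately show "integrable (base (nik \<rho> 0 k)) (\<lambda>x. of_real x ^ \<nu> * linear_form m1 \<sigma>1 a (of_real x)) \<and>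
    cs_integral (nik \<rho> 0 k) (\<lambda>x. of_real x ^ \<nu> * linear_form m1 \<sigma>1 a (of_real x)) = 0"
    by (simp add: h_def[abs_def] A_def)
qed

end
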